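(* Let $A$ be a multiplicative character of $\mathbb{F}_q$ with $A^2\neq\varepsilon$, $A^6\neq\varepsilon$ and $A^4\neq\varphi$. Then \begin{align*} &{}_3F_2(\overline{A^2},A^2,\varphi;\,A^4,\overline{A^4}\mid -8)\\ &=\frac{g(\varphi)}{g(\overline{A^4})\,g(A^4\varphi)}\binom{\overline{A^2}}{\overline{A^4}}^{-1}\left[\binom{\overline{A}}{A^2}+\binom{\varphi\overline{A}}{A^2}\right]\left[\binom{A}{\overline{A^2}}+\binom{\varphi A}{\overline{A^2}}\right]\\ &\quad+\frac{q-1}{q}\binom{\overline{A^2}}{\overline{A^4}}^{-1}{}_3F_2(A^2,\overline{A^2},\varphi;\,\varepsilon,\overline{A^4}\mid -8)\,\delta(\overline{A^4})-\frac{1}{q^2}\binom{\varphi}{\overline{A^4}}\binom{\overline{A^2}}{\overline{A^4}}^{-1}\\ &\quad-\frac{(q-1)\,g(\varphi)}{q^3\,g(\overline{A^4})\,g(A^4\varphi)}\binom{\overline{A^2}}{\overline{A^4}}^{-1}\big[\delta(\overline{A^4})+q\big]. \end{align*}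
   Context: Let $p$ be an odd prime, $q=p^r$, and $\mathbb{F}_q$ the field with $q$ elements. Multiplicative characters of $\mathbb{F}_q^\times$ are extended to $\mathbb{F}_q$ by $\chi(0)=0$ (including the trivial character $\varepsilon$). $\varphi$ is the quadratic character. Characters are multiplied pointwise and $\overline{A}$ is the inverse of $A$. For a character $A$, $\delta(A)=1$ if $A=\varepsilon$ and $0$ otherwise. The Gauss sum is $g(\chi)=\sum_{x\in\mathbb{F}_q}\chi(x)\theta(x)$ with $\theta(\alpha)=\zeta_p^{\mathrm{tr}(\alpha)}$, $\zeta_p$ a fixed primitive $p$-th root of unity, $\mathrm{tr}$ the trace to $\mathbb{F}_p$. The binomial coefficient is $\binom{A}{B}=\frac{B(-1)}{q}\sum_{x\in\mathbb{F}_q}A(x)\overline{B}(1-x)$. Greene's series: ${}_{n+1}F_n(A_0,\dots,A_n;\,B_1,\dots,B_n\mid x)=\frac{q}{q-1}\sum_{\chi}\binom{A_0\chi}{\chi}\prod_{i=1}^n\binom{A_i\chi}{B_i\chi}\chi(x)$, summed over all multiplicative characters $\chi$.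
   Formalization: The formal theorem assumes in addition that p ≠ 3: in characteristic 3 one has −8 = 1 and the formula is false (for q = 9 and A of order 4 the left side is 2/9 and the right side 11/9). *)

theory Defs
  imports
    Complex_Main
    "HOL-Library.Cardinality"
    "HOL-Library.Function_Division"
    "HOL-Computational_Algebra.Computational_Algebra"
begin

text \<open>
  A multiplicative character is represented by its extension by 0 to the whole field. Products,
  powers with positive exponent and inverses of characters are the pointwise operations of
  HOL-Library.Function_Division (with \<open>inverse 0 = 0\<close>). Beware that the constant function
  \<open>1\<close> is not the trivial character, which vanishes at 0.
\<close>

definition mult_char :: "('a::finite_field \<Rightarrow> complex) \<Rightarrow> bool" where
  "mult_char \<chi> \<longleftrightarrow> \<chi> 0 = 0 \<and> \<chi> 1 = 1 \<and> (\<forall>x y. \<chi> (x * y) = \<chi> x * \<chi> y)"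

definition triv_char :: "'a::finite_field \<Rightarrow> complex" where
  "triv_char x = (if x = 0 then 0 else 1)"

definition quad_char :: "'a::finite_field \<Rightarrow> complex" where
  "quad_char x = (if x = 0 then 0 else if \<exists>y. x = y ^ 2 then 1 else - 1)"

definition delta_char :: "('a::finite_field \<Rightarrow> complex) \<Rightarrow> complex" where
  "delta_char \<chi> = (if \<chi> = triv_char then 1 else 0)"

definition primitive_root_of_unity :: "nat \<Rightarrow> complex \<Rightarrow> bool" where
  "primitive_root_of_unity n \<zeta> \<longleftrightarrow> \<zeta> ^ n = 1 \<and> (\<forall>k. 0 < k \<and> k < n \<longrightarrow> \<zeta> ^ k \<noteq> 1)"

text \<open>The trace from the field with \<open>p ^ r\<close> elements to its prime field.\<close>

definition field_trace :: "nat \<Rightarrow> nat \<Rightarrow> 'a::finite_field \<Rightarrow> 'a" where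
  "field_trace p r x = (\<Sum>i<r. x ^ (p ^ i))"

text \<open>The exponent is the representative in \<open>{0..<p}\<close> of the trace, an element of the prime field.\<close>

definition add_char :: "nat \<Rightarrow> nat \<Rightarrow> complex \<Rightarrow> 'a::finite_field \<Rightarrow> complex" where
  "add_char p r \<zeta> x = \<zeta> ^ (THE k. k < p \<and> of_nat k = field_trace p r x)"

definition gauss_sum :: "nat \<Rightarrow> nat \<Rightarrow> complex \<Rightarrow> ('a::finite_field \<Rightarrow> complex) \<Rightarrow> complex" where
  "gauss_sum p r \<zeta> \<chi> = (\<Sum>x\<in>UNIV. \<chi> x * add_char p r \<zeta> x)"

definition char_binom :: "('a::finite_field \<Rightarrow> complex) \<Rightarrow> ('a \<Rightarrow> complex) \<Rightarrow> complex" where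
  "char_binom A B = B (- 1) / of_nat CARD('a) * (\<Sum>x\<in>UNIV. A x * inverse B (1 - x))"

text \<open>
  \<open>greene_F A\<^sub>0 [A\<^sub>1, \<dots>, A\<^sub>n] [B\<^sub>1, \<dots>, B\<^sub>n] x\<close> is Greene's \<open>{n+1}F{n}\<close>; the two lists are meant to
  have equal length.
\<close>

definition greene_F ::
  "('a::finite_field \<Rightarrow> complex) \<Rightarrow> ('a \<Rightarrow> complex) list \<Rightarrow> ('a \<Rightarrow> complex) list \<Rightarrow> 'a \<Rightarrow> complex"
where
  "greene_F A0 As Bs x =
     of_nat CARD('a) / (of_nat CARD('a) - 1) *
     (\<Sum>\<chi> | mult_char \<chi>. char_binom (A0 * \<chi>) \<chi> *
        (\<Prod>i<length Bs. char_binom (As ! i * \<chi>) (Bs ! i * \<chi>)) * \<chi> x)"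

text \<open>
  At \<open>x = - 8\<close> characteristic 3 is degenerate, since then \<open>- 8 = 1\<close>, and the evaluation with
  parameters \<open>A ^ (-2), A ^ 2, \<phi>; A ^ 4, A ^ (-4)\<close> is false there: for the field with 9 elements and
  \<open>A\<close> of order 4 its two sides are 2/9 and 11/9. It is therefore stated for primes \<open>p \<noteq> 3\<close>.
\<close>

lemma fun_power_apply: "(f ^ n) x = f x ^ n" for f :: "'a \<Rightarrow> 'b::monoid_mult"
  by (induction n) simp_all

lemma mult_char_triv: "mult_char triv_char"
  by (simp add: mult_char_def triv_char_def)

lemma mult_char_mult: "mult_char A \<Longrightarrow> mult_char B \<Longrightarrow> mult_char (A * B)"
  by (simp add: mult_char_def)

lemma mult_char_inverse: "mult_char A \<Longrightarrow> mult_char (inverse A)"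
  by (simp add: mult_char_def)

lemma mult_char_mult_inverse:
  assumes "mult_char A"
  shows "A * inverse A = triv_char"
proof
  fix x
  have "A x \<noteq> 0" if "x \<noteq> 0"
  proof -
    have "A x * A (inverse x) = 1"
      using assms that unfolding mult_char_def by (metis right_inverse)
    then show ?thesis by auto
  qed
  then show "(A * inverse A) x = triv_char x"
    using assms by (simp add: triv_char_def mult_char_def)
qed

text \<open>In particular the sum in Greene's series is a genuine finite sum.\<close>

lemma finite_mult_chars: "finite {\<chi> :: 'a::finite_field \<Rightarrow> complex. mult_char \<chi>}"
proof -
  let ?q = "CARD('a)"
  let ?R = "insert 0 {z :: complex. z ^ (?q - 1) = 1}"
  have "card {0, 1 :: 'a} \<le> ?q"
    by (rule card_mono) auto
  then have q: "?q \<ge> 2" by simp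
  have "\<chi> x \<in> ?R" if "mult_char \<chi>" for \<chi> :: "'a \<Rightarrow> complex" and x
  proof -
    have "\<chi> (x ^ n) = \<chi> x ^ n" for n
      using that by (induction n) (simp_all add: mult_char_def)
    from this[of ?q] have "\<chi> x ^ ?q = \<chi> x"
      by (simp add: finite_field_power_card_eq_same)
    moreover have "\<chi> x ^ ?q = \<chi> x * \<chi> x ^ (?q - 1)"
      using q by (intro power_eq_if[THEN trans]) simp
    ultimately show ?thesis by auto
  qed
  then have "{\<chi> :: 'a \<Rightarrow> complex. mult_char \<chi>} \<subseteq> PiE UNIV (\<lambda>_. ?R)"
    by (auto simp: PiE_def)
  moreover have "finite (PiE (UNIV :: 'a set) (\<lambda>_. ?R))"
    using q by (intro finite_PiE) (auto intro: finite_roots_unity)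
  ultimately show ?thesis by (rule finite_subset)
qed

end

theory Submission
  imports Defs "HOL-Algebra.Multiplicative_Group" "HOL-Number_Theory.Cong"
begin

text \<open>
  Write \<open>B = A\<^sup>2\<close>. By the finite field form of Kummer's theorem, the product of the two brackets is
  \<open>1/q\<^sup>2\<close> times the product \<open>P\<close> of the sums of \<open>B\<close> and of its inverse over the values of the cubic
  \<open>y\<^sup>3 - y\<close>. The theorem is thus the finite field counterpart, at \<open>x = -1\<close>, \<open>4x(1-x) = -8\<close>, of
  Bailey's factorisation of a \<open>4F3\<close> in the argument \<open>4x(1-x)\<close> as a product of two \<open>2F1\<close> in \<open>x\<close>,
  which passes through the Appell function \<open>F4\<close>.

  The birational map \<open>a = (1+y)/z\<close>, \<open>b = (1+z)/y\<close> turns \<open>P\<close> into an \<open>F4\<close>-like double sum; the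
  contributions of the exceptional curves on both sides cancel. Expanding \<open>B\<close> in additive characters
  brings the double sum into a form which depends on one ratio only through a one-parameter family
  of sums, and Mellin inversion over the multiplicative group turns it into a sum over characters of
  products of three Jacobi sums. In terms of Gauss sums, and by the quadratic Hasse-Davenport
  relation, it agrees term by term with Greene's series, up to a correction at the trivial character.
\<close>

section \<open>Multiplicative characters\<close>

text \<open>In Greene's series the two characters of each Jacobi sum have a product free of
  \<open>\<chi>\<close>, so fixed Gauss sums clear all denominators. On the Mellin side these
  products vary with \<open>\<chi>\<close> and can become trivial, hence a second Gauss sum formula
  for Jacobi sums. The argument splits as \<open>8 = 2 * 4\<close>: the shifts \<open>-2\<close> of
  the double sum give \<open>\<chi> 2\<close>, and Hasse-Davenport applied to
  \<open>\<chi> * \<chi>\<close> gives \<open>\<chi> 4\<close>; that square arises because the two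
  shifts are equal. The comparison ends in \<open>P - q\<close> with \<open>q = (q - 1) + 1\<close>:
  \<open>q - 1\<close> is a degenerate fibre of the double sum, \<open>1\<close> stems from the
  trivial character. The last two terms of the theorem encode this \<open>q\<close>. If
  \<open>A ^ 4\<close> is trivial, the delta term contains the evaluated series itself, and the
  formula is a linear equation for it. The hypotheses guard against degenerations:
  \<open>A ^ 2 \<noteq> \<epsilon>\<close> makes \<open>B\<close> nontrivial,
  \<open>A ^ 6 \<noteq> \<epsilon>\<close> serves the curve \<open>a b = 1\<close>, where the
  summand is a value of \<open>B ^ 3\<close>, \<open>p \<noteq> 3\<close> serves the line
  \<open>y + z + 1 = 0\<close>, and \<open>A ^ 4 \<noteq> \<phi>\<close> keeps
  \<open>\<phi> * (B * B)\<close> nontrivial.\<close>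

lemma mult_char_0: "mult_char \<chi> \<Longrightarrow> \<chi> 0 = 0"
  by (simp add: mult_char_def)

lemma mult_char_1: "mult_char \<chi> \<Longrightarrow> \<chi> 1 = 1"
  by (simp add: mult_char_def)

lemma mult_char_times: "mult_char \<chi> \<Longrightarrow> \<chi> (x * y) = \<chi> x * \<chi> y"
  by (simp add: mult_char_def)

lemma mult_char_eq_0_iff:
  assumes "mult_char \<chi>"
  shows "\<chi> x = 0 \<longleftrightarrow> x = 0"
proof -
  have "\<chi> x * \<chi> (inverse x) = 1" if "x \<noteq> 0"
    using that assms by (simp add: mult_char_1 flip: mult_char_times[OF assms])
  then show ?thesis using mult_char_0[OF assms] by fastforce
qed

lemma mult_char_inverse_arg:
  assumes "mult_char \<chi>"
  shows "\<chi> (inverse x) = inverse (\<chi> x)"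
proof (cases "x = 0")
  case False
  then have "\<chi> x * \<chi> (inverse x) = 1"
    using assms by (simp add: mult_char_1 flip: mult_char_times[OF assms])
  then show ?thesis by (simp add: inverse_unique)
qed (use assms in \<open>simp add: mult_char_0\<close>)

lemma mult_char_divide: "mult_char \<chi> \<Longrightarrow> \<chi> (x / y) = \<chi> x / \<chi> y"
  by (simp add: divide_inverse mult_char_times mult_char_inverse_arg)

lemma mult_char_power: "mult_char \<chi> \<Longrightarrow> \<chi> (x ^ n) = \<chi> x ^ n"
  by (induction n) (simp_all add: mult_char_times mult_char_1)

lemma mult_char_minus_1_square:
  assumes "mult_char \<chi>"
  shows "\<chi> (- 1) * \<chi> (- 1) = 1"
  using assms by (simp add: mult_char_1 flip: mult_char_times[OF assms])

lemma mult_char_minus: "mult_char \<chi> \<Longrightarrow> \<chi> (- x) = \<chi> (- 1) * \<chi> x"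
  using mult_char_times[of \<chi> "- 1" x] by simp

lemma mult_char_power_char:
  assumes "mult_char \<chi>" "n > 0"
  shows "mult_char (\<chi> ^ n)"
  using assms unfolding mult_char_def by (simp add: fun_power_apply power_mult_distrib)

lemma inverse_char_mult: "inverse (\<chi> * \<psi>) = inverse \<chi> * inverse \<psi>"
  for \<chi> \<psi> :: "'a \<Rightarrow> complex"
  by (simp add: fun_eq_iff)

lemma inverse_char_inverse [simp]: "inverse (inverse \<chi>) = \<chi>"
  for \<chi> :: "'a \<Rightarrow> complex"
  by (simp add: fun_eq_iff)

lemma inverse_triv_char [simp]: "inverse triv_char = triv_char"
  by (simp add: fun_eq_iff triv_char_def)

lemma triv_char_mult: "mult_char \<chi> \<Longrightarrow> triv_char * \<chi> = \<chi>"
  by (auto simp: fun_eq_iff triv_char_def mult_char_0)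

lemma mult_triv_char: "mult_char \<chi> \<Longrightarrow> \<chi> * triv_char = \<chi>"
  by (auto simp: fun_eq_iff triv_char_def mult_char_0)

lemma mult_inverse_char_cancel:
  assumes "mult_char \<chi>" "mult_char \<psi>"
  shows "\<chi> * inverse \<chi> * \<psi> = \<psi>"
  using assms by (simp add: mult_char_mult_inverse triv_char_mult)

lemma mult_inverse_char_cancel':
  assumes "mult_char \<chi>" "mult_char \<psi>"
  shows "\<chi> * (inverse \<chi> * \<psi>) = \<psi>" "inverse \<chi> * (\<chi> * \<psi>) = \<psi>"
  using mult_inverse_char_cancel[OF assms] by (simp_all add: mult_ac)

lemma inverse_char_eq_triv_iff: "inverse \<chi> = triv_char \<longleftrightarrow> \<chi> = triv_char"
  by (metis inverse_char_inverse inverse_triv_char)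

lemma char_eq_inverse_iff:
  assumes "mult_char \<chi>" "mult_char \<psi>"
  shows "\<chi> * \<psi> = triv_char \<longleftrightarrow> \<psi> = inverse \<chi>"
proof
  assume *: "\<chi> * \<psi> = triv_char"
  have "\<psi> = \<chi> * inverse \<chi> * \<psi>"
    using assms by (simp add: mult_inverse_char_cancel)
  also have "\<dots> = inverse \<chi> * (\<chi> * \<psi>)"
    by (simp add: mult_ac)
  finally show "\<psi> = inverse \<chi>"
    using assms by (simp add: * mult_triv_char mult_char_inverse)
qed (use assms in \<open>simp add: mult_char_mult_inverse\<close>)

section \<open>Reindexing, orthogonality and duality on the multiplicative group\<close>

lemma sum_UNIV_scale:
  fixes f :: "'a::{field,finite} \<Rightarrow> 'b::comm_monoid_add"
  assumes "c \<noteq> 0"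
  shows "(\<Sum>x\<in>UNIV. f (c * x)) = (\<Sum>x\<in>UNIV. f x)"
  using assms by (intro sum.reindex_bij_witness[of _ "\<lambda>x. x / c" "\<lambda>x. c * x"]) auto

lemma sum_UNIV_shift:
  fixes f :: "'a::{ab_group_add,finite} \<Rightarrow> 'b::comm_monoid_add"
  shows "(\<Sum>x\<in>UNIV. f (c + x)) = (\<Sum>x\<in>UNIV. f x)"
  by (intro sum.reindex_bij_witness[of _ "\<lambda>x. x - c" "\<lambda>x. c + x"]) auto

lemma sum_UNIV_reflect:
  fixes f :: "'a::{ab_group_add,finite} \<Rightarrow> 'b::comm_monoid_add"
  shows "(\<Sum>x\<in>UNIV. f (c - x)) = (\<Sum>x\<in>UNIV. f x)"
  by (intro sum.reindex_bij_witness[of _ "\<lambda>x. c - x" "\<lambda>x. c - x"]) auto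

lemma sum_UNIV_minus:
  fixes f :: "'a::{ab_group_add,finite} \<Rightarrow> 'b::comm_monoid_add"
  shows "(\<Sum>x\<in>UNIV. f (- x)) = (\<Sum>x\<in>UNIV. f x)"
  using sum_UNIV_reflect[of f 0] by simp

lemma sum_mult_char:
  fixes \<chi> :: "'a::finite_field \<Rightarrow> complex"
  assumes "mult_char \<chi>"
  shows "(\<Sum>x\<in>UNIV. \<chi> x) = (if \<chi> = triv_char then of_nat CARD('a) - 1 else 0)"
proof (cases "\<chi> = triv_char")
  case True
  have "(\<Sum>x\<in>UNIV. \<chi> x) = (\<Sum>x\<in>UNIV - {0::'a}. 1)"
    unfolding True triv_char_def by (intro sum.mono_neutral_cong_right) auto
  also have "\<dots> = of_nat (CARD('a) - 1)"
    by (simp add: card_Diff_subset)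
  finally show ?thesis
    using True by (simp add: of_nat_diff Suc_leI)
next
  case False
  then obtain c where "\<chi> c \<noteq> triv_char c" by auto
  then have c: "c \<noteq> 0" "\<chi> c \<noteq> 1"
    using mult_char_0[OF assms] by (auto simp: triv_char_def split: if_splits)
  have "(\<Sum>x\<in>UNIV. \<chi> x) = \<chi> c * (\<Sum>x\<in>UNIV. \<chi> x)"
    using sum_UNIV_scale[OF c(1), of \<chi>] assms by (simp add: mult_char_times sum_distrib_left)
  then show ?thesis
    using c False by (simp add: algebra_simps)
qed

text \<open>The type class structure is repackaged as a ring record, so that the cyclicity theorem
  of HOL-Algebra for multiplicative groups of finite fields applies.\<close>

lemma finite_field_generator:
  obtains g :: "'a::finite_field" where "\<And>x. x \<noteq> 0 \<Longrightarrow> \<exists>i::nat. x = g ^ i"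
proof -
  define R :: "'a ring" where
    "R = \<lparr>carrier = UNIV, monoid.mult = (*), one = 1, zero = 0, add = (+)\<rparr>"
  have R_simps: "carrier R = UNIV" "monoid.mult R = (*)" "one R = 1" "zero R = 0" "add R = (+)"
    by (simp_all add: R_def)
  have "cring R"
  proof (intro cringI abelian_groupI comm_monoidI)
    show "\<exists>y\<in>carrier R. y \<oplus>\<^bsub>R\<^esub> x = \<zero>\<^bsub>R\<^esub>" for x
      unfolding R_simps by (intro bexI[of _ "- x"]) auto
  qed (simp_all add: R_simps algebra_simps)
  then have "Ring.field R"
  proof (rule cring.cring_fieldI)
    have "x \<noteq> 0 \<Longrightarrow> \<exists>y. x * y = 1 \<and> y * x = 1" for x :: 'a
      by (intro exI[of _ "inverse x"]) auto
    then show "Units R = carrier R - {\<zero>\<^bsub>R\<^esub>}"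
      unfolding Units_def R_simps by (auto simp: mult.commute)
  qed
  then interpret R: Ring.field R .
  have pow: "x [^]\<^bsub>R\<^esub> n = x ^ n" for x and n :: nat
    by (induction n) (simp_all add: R_simps mult.commute)
  obtain g where "carrier (mult_of R) = {g [^]\<^bsub>R\<^esub> i | i::nat. i \<in> UNIV}"
    using R.finite_field_mult_group_has_gen by (auto simp: R_simps)
  then have "UNIV - {0} = {g ^ i | i::nat. i \<in> UNIV}"
    by (simp add: pow R_simps)
  then show ?thesis
    by (intro that[of g]) blast
qed

lemma finite_field_power_card_minus_1:
  "x \<noteq> 0 \<Longrightarrow> x ^ (CARD('a) - 1) = 1" for x :: "'a::finite_field"
  using finite_field_power_card_eq_same[of x] power_eq_if[of x "CARD('a)"] by auto

text \<open>Sending a generator to a root of unity of exact order \<open>N = q - 1\<close> gives a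
  faithful character, so one and the same \<open>\<chi>\<close> serves every
  \<open>x\<close>.\<close>

lemma ex_mult_char_neq_1:
  fixes x :: "'a::finite_field"
  assumes "x \<noteq> 1" "x \<noteq> 0"
  obtains \<chi> :: "'a \<Rightarrow> complex" where "mult_char \<chi>" "\<chi> x \<noteq> 1"
proof -
  obtain g :: 'a where g: "\<And>x. x \<noteq> 0 \<Longrightarrow> \<exists>i::nat. x = g ^ i"
    using finite_field_generator by blast
  have g0: "g \<noteq> 0"
  proof
    assume "g = 0"
    obtain i where "x = g ^ i" using g[of x] assms by auto
    with \<open>g = 0\<close> show False using assms by (cases "i = 0") auto
  qed
  define N where "N = CARD('a) - 1"
  have "card {0, 1 :: 'a} \<le> CARD('a)"
    by (rule card_mono) auto
  then have N: "N > 0" by (simp add: N_def)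
  have gN: "g ^ N = 1"
    unfolding N_def using g0 by (rule finite_field_power_card_minus_1)
  have g_mod: "g ^ (i mod N) = g ^ i" for i
  proof -
    have "g ^ i = g ^ (N * (i div N) + i mod N)" by simp
    also have "\<dots> = g ^ (i mod N)" by (simp only: power_add power_mult gN) simp
    finally show ?thesis ..
  qed
  have image: "(\<lambda>i. g ^ i) ` {..<N} = UNIV - {0}"
  proof (intro equalityI subsetI)
    fix y :: 'a assume "y \<in> UNIV - {0}"
    then obtain i where "y = g ^ i" using g[of y] by auto
    then have "y = g ^ (i mod N)" by (simp add: g_mod)
    then show "y \<in> (\<lambda>i. g ^ i) ` {..<N}" using N by auto
  qed (use g0 in auto)
  \<comment> \<open>By counting: \<open>{..<N}\<close> is mapped onto the nonzero elements, of which
    there are \<open>N\<close>.\<close>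
  have "inj_on (\<lambda>i. g ^ i) {..<N}"
    by (rule eq_card_imp_inj_on) (simp, unfold image, simp add: N_def card_Diff_subset)
  then have inj: "i mod N = j mod N" if "g ^ i = g ^ j" for i j
    using that N g_mod[of i] g_mod[of j] by (auto simp: inj_on_def)
  define \<omega> where "\<omega> = cis (2 * pi / real N)"
  have \<omega>_power: "\<omega> ^ i = cis (2 * pi * real i / real N)" for i
    by (simp add: \<omega>_def DeMoivre mult_ac)
  have \<omega>N: "\<omega> ^ N = 1" using N by (simp add: \<omega>_power)
  have \<omega>_mod: "\<omega> ^ (i mod N) = \<omega> ^ i" for i
  proof -
    have "\<omega> ^ i = \<omega> ^ (N * (i div N) + i mod N)" by simp
    also have "\<dots> = \<omega> ^ (i mod N)" by (simp only: power_add power_mult \<omega>N) simp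
    finally show ?thesis ..
  qed
  \<comment> \<open>A discrete logarithm, chosen arbitrarily; only its class modulo \<open>N\<close>
    matters, and \<open>l_power\<close> records that \<open>\<omega> ^ l y\<close> does not see the
    choice.\<close>
  define l where "l = (\<lambda>x. SOME i. x = g ^ i)"
  have l: "y = g ^ l y" if "y \<noteq> 0" for y
    unfolding l_def using g[OF that] by (rule someI_ex)
  have l_power: "\<omega> ^ l y = \<omega> ^ i" if "y = g ^ i" for y i
    using inj[of "l y" i] l[of y] that g0 \<omega>_mod by (metis power_not_zero)
  define \<chi> where "\<chi> = (\<lambda>y. if y = 0 then 0 else \<omega> ^ l y)"
  have "\<chi> (y * z) = \<chi> y * \<chi> z" for y z
  proof (cases "y = 0 \<or> z = 0")
    case False
    then have "y * z = g ^ (l y + l z)"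
      using l[of y] l[of z] by (simp add: power_add)
    from l_power[OF this] show ?thesis
      using False by (simp add: \<chi>_def power_add)
  qed (auto simp: \<chi>_def)
  moreover have "\<chi> 1 = 1"
    using l_power[of 1 0] by (simp add: \<chi>_def)
  ultimately have "mult_char \<chi>"
    by (simp add: mult_char_def \<chi>_def)
  moreover have "\<chi> x \<noteq> 1"
  proof
    assume *: "\<chi> x = 1"
    define i where "i = l x mod N"
    have i: "i < N" using N by (simp add: i_def)
    have x: "x = g ^ i" using l[of x] assms by (simp add: i_def g_mod)
    then have "i \<noteq> 0" using assms by (cases "i = 0") auto
    from * l_power[OF x] have "cis (2 * pi * real i / real N) = 1"
      using assms by (simp add: \<chi>_def \<omega>_power)
    then have "cos (2 * pi * real i / real N) = 1"
      by (metis cis.simps(1) one_complex.simps(1))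
    then obtain k :: int where "2 * pi * real i / real N = real_of_int k * 2 * pi"
      by (auto simp: cos_one_2pi_int)
    then have "real i = real_of_int k * real N"
      using N by (simp add: field_simps)
    then have "int i = k * int N"
      by (metis of_int_eq_iff of_int_mult of_int_of_nat_eq)
    then have "int N dvd int i" by simp
    then show False using i \<open>i \<noteq> 0\<close> by (auto dest: dvd_imp_le)
  qed
  ultimately show ?thesis by (rule that)
qed

text \<open>Translating the sum by a character with \<open>\<psi> x \<noteq> 1\<close> multiplies it
  by \<open>\<psi> x\<close>. At \<open>x = 0\<close> every term vanishes.\<close>

lemma sum_mult_chars_eval_neq_1:
  fixes x :: "'a::finite_field"
  assumes "x \<noteq> 1"
  shows "(\<Sum>\<chi> | mult_char \<chi>. \<chi> x) = 0"
proof (cases "x = 0")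
  case False
  then obtain \<psi> :: "'a \<Rightarrow> complex" where \<psi>: "mult_char \<psi>" "\<psi> x \<noteq> 1"
    using assms ex_mult_char_neq_1 by blast
  have "(\<Sum>\<chi> | mult_char \<chi>. \<chi> x) = (\<Sum>\<chi> | mult_char \<chi>. (\<psi> * \<chi>) x)"
    using \<psi>(1) by (intro sum.reindex_bij_witness[of _ "\<lambda>\<chi>. \<psi> * \<chi>" "\<lambda>\<chi>. inverse \<psi> * \<chi>"])
      (auto simp: mult_char_mult mult_char_inverse mult_inverse_char_cancel')
  then have "(\<Sum>\<chi> | mult_char \<chi>. \<chi> x) = \<psi> x * (\<Sum>\<chi> | mult_char \<chi>. \<chi> x)"
    by (simp flip: sum_distrib_left)
  then show ?thesis using \<psi>(2) by (simp add: algebra_simps)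
qed (simp add: mult_char_0)

lemma sum_mult_chars_eval_1:
  "(\<Sum>\<chi> | mult_char \<chi>. \<chi> (1::'a::finite_field)) = of_nat (card {\<chi>::'a \<Rightarrow> complex. mult_char \<chi>})"
proof -
  have "(\<Sum>\<chi> | mult_char \<chi>. \<chi> (1::'a)) = (\<Sum>\<chi>::'a \<Rightarrow> complex | mult_char \<chi>. 1)"
    by (intro sum.cong) (auto simp: mult_char_def)
  then show ?thesis by simp
qed

text \<open>The double sum of \<open>\<chi> x\<close> over all \<open>x\<close> and
  \<open>\<chi>\<close> is evaluated in both orders: only \<open>x = 1\<close> survives in one, only
  the trivial character in the other.\<close>

lemma card_mult_chars:
  "of_nat (card {\<chi> :: 'a::finite_field \<Rightarrow> complex. mult_char \<chi>}) = (of_nat CARD('a) - 1 :: complex)"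
proof -
  let ?C = "{\<chi> :: 'a \<Rightarrow> complex. mult_char \<chi>}"
  have "(\<Sum>x\<in>UNIV. \<Sum>\<chi>\<in>?C. \<chi> x) = (\<Sum>x\<in>{1::'a}. \<Sum>\<chi>\<in>?C. \<chi> x)"
    by (intro sum.mono_neutral_right) (auto simp: sum_mult_chars_eval_neq_1)
  also have "\<dots> = of_nat (card ?C)" by (simp add: sum_mult_chars_eval_1)
  finally have *: "of_nat (card ?C) = (\<Sum>x\<in>UNIV. \<Sum>\<chi>\<in>?C. \<chi> x)" ..
  have "of_nat (card ?C) = (\<Sum>\<chi>\<in>?C. \<Sum>x\<in>UNIV. \<chi> x)"
    unfolding * by (rule sum.swap)
  also have "\<dots> = (\<Sum>\<chi>\<in>?C. if \<chi> = triv_char then of_nat CARD('a) - 1 else 0)"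
    by (intro sum.cong) (auto simp: sum_mult_char)
  also have "\<dots> = of_nat CARD('a) - 1"
    by (simp add: finite_mult_chars mult_char_triv sum.delta)
  finally show ?thesis .
qed

text \<open>Fourier inversion on the multiplicative group. The value \<open>f 0\<close> never
  enters, since characters vanish at \<open>0\<close>, hence the restriction on
  \<open>x\<close>.\<close>

lemma mellin_inversion:
  fixes f :: "'a::finite_field \<Rightarrow> complex"
  assumes "x \<noteq> 0"
  shows "(of_nat CARD('a) - 1) * f x = (\<Sum>\<chi> | mult_char \<chi>. \<chi> x * (\<Sum>y\<in>UNIV. inverse \<chi> y * f y))"
proof -
  have "(\<Sum>\<chi> | mult_char \<chi>. \<chi> x * (\<Sum>y\<in>UNIV. inverse \<chi> y * f y)) =
        (\<Sum>\<chi> | mult_char \<chi>. \<Sum>y\<in>UNIV. f y * \<chi> (x / y))"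
    by (intro sum.cong) (auto simp: sum_distrib_left mult_char_divide field_simps)
  also have "\<dots> = (\<Sum>y\<in>UNIV. f y * (\<Sum>\<chi> | mult_char \<chi>. \<chi> (x / y)))"
    by (subst sum.swap) (simp add: sum_distrib_left)
  also have "\<dots> = (\<Sum>y\<in>{x}. f y * (\<Sum>\<chi> | mult_char \<chi>. \<chi> (x / y)))"
  proof (intro sum.mono_neutral_right ballI)
    fix y assume "y \<in> UNIV - {x}"
    then have "x / y \<noteq> 1" by (cases "y = 0") auto
    then show "f y * (\<Sum>\<chi> | mult_char \<chi>. \<chi> (x / y)) = 0"
      by (simp add: sum_mult_chars_eval_neq_1)
  qed auto
  also have "\<dots> = (of_nat CARD('a) - 1) * f x"
    using assms by (simp add: sum_mult_chars_eval_1 card_mult_chars)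
  finally show ?thesis ..
qed

section \<open>Gauss and Jacobi sums\<close>

definition jacobi_sum :: "('a::finite_field \<Rightarrow> complex) \<Rightarrow> ('a \<Rightarrow> complex) \<Rightarrow> complex" where
  "jacobi_sum \<chi> \<psi> = (\<Sum>x\<in>UNIV. \<chi> x * \<psi> (1 - x))"

lemma char_binom_jacobi: "char_binom A B = B (- 1) / of_nat CARD('a) * jacobi_sum A (inverse B)"
  for A B :: "'a::finite_field \<Rightarrow> complex"
  by (simp add: char_binom_def jacobi_sum_def)

lemma jacobi_sum_commute: "jacobi_sum \<chi> \<psi> = jacobi_sum \<psi> \<chi>"
  using sum_UNIV_reflect[of "\<lambda>x. \<chi> x * \<psi> (1 - x)" 1] by (simp add: jacobi_sum_def mult_ac)

lemma jacobi_sum_scale: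
  fixes \<chi> \<psi> :: "'a::finite_field \<Rightarrow> complex"
  assumes "mult_char \<chi>" "mult_char \<psi>" "s \<noteq> 0"
  shows "(\<Sum>x\<in>UNIV. \<chi> x * \<psi> (s - x)) = (\<chi> * \<psi>) s * jacobi_sum \<chi> \<psi>"
proof -
  have "(\<Sum>x\<in>UNIV. \<chi> x * \<psi> (s - x)) = (\<Sum>x\<in>UNIV. \<chi> (s * x) * \<psi> (s - s * x))"
    using sum_UNIV_scale[OF assms(3), of "\<lambda>x. \<chi> x * \<psi> (s - x)"] by simp
  also have "\<dots> = (\<Sum>x\<in>UNIV. \<chi> (s * x) * \<psi> (s * (1 - x)))"
    by (simp add: algebra_simps)
  also have "\<dots> = (\<chi> * \<psi>) s * jacobi_sum \<chi> \<psi>"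
    unfolding jacobi_sum_def sum_distrib_left
    by (intro sum.cong refl) (simp add: mult_char_times[OF assms(1)] mult_char_times[OF assms(2)])
  finally show ?thesis .
qed

lemma jacobi_sum_triv_right:
  fixes \<chi> :: "'a::finite_field \<Rightarrow> complex"
  assumes "mult_char \<chi>" "\<chi> \<noteq> triv_char"
  shows "jacobi_sum \<chi> triv_char = - 1"
proof -
  have "jacobi_sum \<chi> triv_char = (\<Sum>x\<in>UNIV. \<chi> x - (if x = 1 then \<chi> 1 else 0))"
    unfolding jacobi_sum_def by (intro sum.cong) (auto simp: triv_char_def)
  then show ?thesis
    using assms by (simp add: sum_subtractf sum_mult_char mult_char_1)
qed

lemma jacobi_sum_triv_triv:
  "jacobi_sum triv_char (triv_char :: 'a::finite_field \<Rightarrow> complex) = of_nat CARD('a) - 2"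
proof -
  have "jacobi_sum triv_char (triv_char :: 'a \<Rightarrow> complex) =
      (\<Sum>x\<in>UNIV. triv_char x - (if x = (1::'a) then 1 else 0))"
    unfolding jacobi_sum_def by (intro sum.cong) (auto simp: triv_char_def)
  then show ?thesis
    by (simp add: sum_subtractf sum_mult_char mult_char_triv)
qed

text \<open>The map \<open>x / (1 - x)\<close> takes the field without \<open>1\<close> onto the
  field without \<open>-1\<close>, so a full character sum lacks just its value at
  \<open>-1\<close>.\<close>

lemma jacobi_sum_inverse:
  fixes \<chi> :: "'a::finite_field \<Rightarrow> complex"
  assumes "mult_char \<chi>" "\<chi> \<noteq> triv_char"
  shows "jacobi_sum \<chi> (inverse \<chi>) = - \<chi> (- 1)"
proof -
  have "jacobi_sum \<chi> (inverse \<chi>) = (\<Sum>x\<in>UNIV - {1}. \<chi> (x / (1 - x)))"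
    unfolding jacobi_sum_def using assms
    by (intro sum.mono_neutral_cong_right) (auto simp: mult_char_0 mult_char_divide divide_inverse
        mult_char_times mult_char_inverse_arg)
  also have "\<dots> = (\<Sum>y\<in>UNIV - {- 1}. \<chi> y)"
  proof (intro sum.reindex_bij_witness[of _ "\<lambda>y. y / (1 + y)" "\<lambda>x. x / (1 - x)"])
    fix y :: 'a assume "y \<in> UNIV - {- 1}"
    then have nz: "1 + y \<noteq> 0" by (auto simp: add_eq_0_iff)
    then have *: "1 - y / (1 + y) = 1 / (1 + y)" by (simp add: field_simps)
    show "y / (1 + y) / (1 - y / (1 + y)) = y" using nz by (simp add: *)
    show "y / (1 + y) \<in> UNIV - {1}" using nz by (auto simp: field_simps)
  next
    fix x :: 'a assume "x \<in> UNIV - {1}"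
    then have nz: "1 - x \<noteq> 0" by auto
    then have *: "1 + x / (1 - x) = 1 / (1 - x)" by (simp add: field_simps)
    show "x / (1 - x) / (1 + x / (1 - x)) = x" using nz by (simp add: *)
    show "x / (1 - x) \<in> UNIV - {- 1}" using nz by (auto simp: field_simps)
  qed auto
  also have "\<dots> = - \<chi> (- 1)"
    using assms by (subst sum_diff1) (auto simp: sum_mult_char)
  finally show ?thesis .
qed

text \<open>What the theory of Gauss sums uses of \<open>add_char\<close>; the trace matters only
  for the later interpretation. Nontriviality appears as \<open>sum_0\<close>, the form in which it
  is applied.\<close>

locale additive_character =
  fixes \<theta> :: "'a::finite_field \<Rightarrow> complex"
  assumes add: "\<theta> (x + y) = \<theta> x * \<theta> y"
    and sum_0: "(\<Sum>x\<in>UNIV. \<theta> x) = 0"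
    and zero: "\<theta> 0 = 1"
begin

definition G :: "('a \<Rightarrow> complex) \<Rightarrow> complex" where
  "G \<chi> = (\<Sum>x\<in>UNIV. \<chi> x * \<theta> x)"

lemma sum_scaled: "(\<Sum>x\<in>UNIV. \<theta> (c * x)) = (if c = 0 then of_nat CARD('a) else 0)"
  using sum_UNIV_scale[of c \<theta>] sum_0 by (simp add: zero)

text \<open>For \<open>c = 0\<close> the left side is a plain character sum, which vanishes just
  when \<open>\<chi>\<close> is nontrivial; this explains the disjunction.\<close>

lemma G_scale:
  assumes "mult_char \<chi>" "c \<noteq> 0 \<or> \<chi> \<noteq> triv_char"
  shows "(\<Sum>x\<in>UNIV. \<chi> x * \<theta> (c * x)) = inverse \<chi> c * G \<chi>"
proof (cases "c = 0")
  case True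
  then show ?thesis using assms by (simp add: zero sum_mult_char mult_char_0)
next
  case False
  have "G \<chi> = (\<Sum>x\<in>UNIV. \<chi> (c * x) * \<theta> (c * x))"
    unfolding G_def using sum_UNIV_scale[OF False, of "\<lambda>x. \<chi> x * \<theta> x"] by simp
  also have "\<dots> = \<chi> c * (\<Sum>x\<in>UNIV. \<chi> x * \<theta> (c * x))"
    by (simp add: mult_char_times[OF assms(1)] sum_distrib_left mult_ac)
  finally show ?thesis
    using mult_char_eq_0_iff[OF assms(1)] False by (simp add: field_simps)
qed

lemma G_triv: "G triv_char = - 1"
proof -
  have "G triv_char = (\<Sum>x\<in>UNIV. \<theta> x - (if x = 0 then 1 else 0))"
    unfolding G_def by (intro sum.cong) (auto simp: triv_char_def zero)
  then show ?thesis by (simp add: sum_subtractf sum_0)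
qed

text \<open>Reading \<open>G_scale\<close> backwards absorbs \<open>inverse \<chi> y\<close> into a
  twisted sum; summing over \<open>y\<close> first then leaves only \<open>x = - 1\<close>.\<close>

lemma G_inverse:
  assumes "mult_char \<chi>" "\<chi> \<noteq> triv_char"
  shows "G \<chi> * G (inverse \<chi>) = \<chi> (- 1) * of_nat CARD('a)"
proof -
  have "G \<chi> * G (inverse \<chi>) = (\<Sum>y\<in>UNIV. \<theta> y * (inverse \<chi> y * G \<chi>))"
    by (simp add: G_def sum_distrib_left sum_distrib_right mult_ac)
  also have "\<dots> = (\<Sum>y\<in>UNIV. \<theta> y * (\<Sum>x\<in>UNIV. \<chi> x * \<theta> (y * x)))"
    using assms by (simp add: G_scale)
  also have "\<dots> = (\<Sum>x\<in>UNIV. \<chi> x * (\<Sum>y\<in>UNIV. \<theta> y * \<theta> (y * x)))"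
    unfolding sum_distrib_left by (subst sum.swap) (simp add: mult_ac)
  also have "\<dots> = (\<Sum>x\<in>UNIV. \<chi> x * (\<Sum>y\<in>UNIV. \<theta> ((1 + x) * y)))"
    by (simp add: algebra_simps flip: add)
  also have "\<dots> = (\<Sum>x\<in>{- 1}. \<chi> x * (\<Sum>y\<in>UNIV. \<theta> ((1 + x) * y)))"
    by (intro sum.mono_neutral_right) (auto simp: sum_scaled add_eq_0_iff)
  finally show ?thesis by (simp add: sum_scaled zero)
qed

text \<open>The value \<open>1\<close> in place of \<open>q\<close> at the trivial character is the
  source of every later factor of the form \<open>if ... then 1 else q\<close>.\<close>

lemma G_inverse':
  assumes "mult_char \<chi>"
  shows "\<chi> (- 1) * (G \<chi> * G (inverse \<chi>)) = (if \<chi> = triv_char then 1 else of_nat CARD('a))"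
proof (cases "\<chi> = triv_char")
  case False
  then have "\<chi> (- 1) * (G \<chi> * G (inverse \<chi>)) = \<chi> (- 1) * \<chi> (- 1) * of_nat CARD('a)"
    using assms by (simp add: G_inverse)
  then show ?thesis using False mult_char_minus_1_square[OF assms] by simp
qed (simp add: G_triv triv_char_def)

lemma G_nonzero:
  assumes "mult_char \<chi>"
  shows "G \<chi> \<noteq> 0"
  using G_inverse'[OF assms] by (auto split: if_splits)

text \<open>The double sum is grouped by \<open>s = x + y\<close>. The layer \<open>s = 0\<close> is
  a multiple of the sum of \<open>\<chi> * \<psi>\<close>, which vanishes because that product is
  nontrivial.\<close>

lemma G_mult:
  assumes "mult_char \<chi>" "mult_char \<psi>" "\<chi> * \<psi> \<noteq> triv_char"
  shows "G \<chi> * G \<psi> = jacobi_sum \<chi> \<psi> * G (\<chi> * \<psi>)"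
proof -
  have "G \<chi> * G \<psi> = (\<Sum>x\<in>UNIV. \<Sum>y\<in>UNIV. \<chi> x * \<psi> y * \<theta> (x + y))"
    by (simp add: G_def sum_product add mult_ac)
  also have "\<dots> = (\<Sum>x\<in>UNIV. \<Sum>s\<in>UNIV. \<chi> x * \<psi> (s - x) * \<theta> s)"
  proof (rule sum.cong[OF refl])
    fix x
    show "(\<Sum>y\<in>UNIV. \<chi> x * \<psi> y * \<theta> (x + y)) = (\<Sum>s\<in>UNIV. \<chi> x * \<psi> (s - x) * \<theta> s)"
      using sum_UNIV_shift[of "\<lambda>s. \<chi> x * \<psi> (s - x) * \<theta> s" x] by simp
  qed
  also have "\<dots> = (\<Sum>s\<in>UNIV. (\<Sum>x\<in>UNIV. \<chi> x * \<psi> (s - x)) * \<theta> s)"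
    unfolding sum_distrib_right by (rule sum.swap)
  also have "\<dots> = (\<Sum>s\<in>UNIV. (\<chi> * \<psi>) s * jacobi_sum \<chi> \<psi> * \<theta> s)"
  proof (intro sum.cong refl)
    fix s :: 'a
    show "(\<Sum>x\<in>UNIV. \<chi> x * \<psi> (s - x)) * \<theta> s = (\<chi> * \<psi>) s * jacobi_sum \<chi> \<psi> * \<theta> s"
    proof (cases "s = 0")
      case True
      have "(\<Sum>x\<in>UNIV. \<chi> x * \<psi> (- x)) = \<psi> (- 1) * (\<Sum>x\<in>UNIV. (\<chi> * \<psi>) x)"
        unfolding sum_distrib_left by (subst mult_char_minus[OF assms(2)]) (simp add: mult_ac)
      then show ?thesis
        using True assms sum_mult_char[OF mult_char_mult[OF assms(1,2)]]
        by (simp add: mult_char_0)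
    qed (use assms in \<open>simp add: jacobi_sum_scale\<close>)
  qed
  also have "\<dots> = jacobi_sum \<chi> \<psi> * G (\<chi> * \<psi>)"
    by (simp add: G_def sum_distrib_left mult_ac)
  finally show ?thesis .
qed

text \<open>
  Unlike the quotient formula of \<open>G_mult\<close>, this form stays valid when the product of the two
  characters is trivial, as long as they are not both trivial.
\<close>

lemma jacobi_sum_eq_G:
  assumes "mult_char \<chi>" "mult_char \<psi>" "\<chi> \<noteq> triv_char \<or> \<psi> \<noteq> triv_char"
  shows "jacobi_sum \<chi> \<psi> = (\<chi> * \<psi>) (- 1) * G \<chi> * G \<psi> * G (inverse (\<chi> * \<psi>)) / of_nat CARD('a)"
proof (cases "\<chi> * \<psi> = triv_char")
  case True
  then have \<psi>: "\<psi> = inverse \<chi>" using assms by (simp add: char_eq_inverse_iff)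
  then have "\<chi> \<noteq> triv_char" using assms(3) by (auto simp: inverse_char_eq_triv_iff)
  then show ?thesis
    unfolding True using assms(1) unfolding \<psi>
    by (simp add: jacobi_sum_inverse G_triv G_inverse triv_char_def)
next
  case False
  have "mult_char (\<chi> * \<psi>)" using assms by (simp add: mult_char_mult)
  from G_inverse'[OF this] have "(\<chi> * \<psi>) (- 1) * G (\<chi> * \<psi>) * G (inverse (\<chi> * \<psi>)) = of_nat CARD('a)"
    using False by (simp add: mult.assoc)
  then have "jacobi_sum \<chi> \<psi> * of_nat CARD('a) = (\<chi> * \<psi>) (- 1) * (jacobi_sum \<chi> \<psi> * G (\<chi> * \<psi>)) * G (inverse (\<chi> * \<psi>))"
    by (simp add: mult_ac)
  also have "\<dots> = (\<chi> * \<psi>) (- 1) * G \<chi> * G \<psi> * G (inverse (\<chi> * \<psi>))"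
    using assms False by (simp add: G_mult mult_ac)
  finally show ?thesis by (simp add: field_simps)
qed

end

section \<open>The quadratic character\<close>

text \<open>Squaring identifies \<open>1\<close> and \<open>- 1\<close>, so on a finite set it
  cannot be surjective.\<close>

lemma ex_nonsquare:
  assumes "(2::'a::finite_field) \<noteq> 0"
  obtains c :: "'a::finite_field" where "\<nexists>y. c = y ^ 2"
proof -
  have "(1::'a) \<noteq> - 1"
    using assms by (metis add.right_inverse one_add_one)
  then have "\<not> inj (\<lambda>y::'a. y ^ 2)"
    by (metis injD power2_minus)
  then have "\<not> surj (\<lambda>y::'a. y ^ 2)"
    by (metis finite finite_UNIV_surj_inj)
  then show ?thesis using that by (auto simp: surj_def)
qed

text \<open>Nonsquares are odd powers of a generator, and two odd exponents add up to an even
  one.\<close>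

lemma nonsquare_mult_nonsquare:
  fixes x y :: "'a::finite_field"
  assumes "\<nexists>z. x = z ^ 2" "\<nexists>z. y = z ^ 2"
  shows "\<exists>z. x * y = z ^ 2"
proof -
  obtain g :: 'a where g: "\<And>x. x \<noteq> 0 \<Longrightarrow> \<exists>i::nat. x = g ^ i"
    using finite_field_generator by blast
  have odd: "\<exists>k. x = g ^ (2 * k + 1)" if "\<nexists>z. x = z ^ 2" for x
  proof -
    have "x \<noteq> 0" using that by (metis power_zero_numeral)
    then obtain i where i: "x = g ^ i" using g by blast
    have "odd i"
    proof
      assume "even i"
      then obtain k where "i = 2 * k" ..
      then have "x = (g ^ k) ^ 2" using i by (simp add: power_mult mult.commute)
      then show False using that by blast
    qed
    then obtain k where "i = 2 * k + 1" by (rule oddE)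
    then show ?thesis using i by blast
  qed
  obtain k l where "x = g ^ (2 * k + 1)" "y = g ^ (2 * l + 1)"
    using odd assms by blast
  then have "x * y = g ^ (2 * (k + l + 1))"
    by (simp flip: power_add)
  also have "\<dots> = (g ^ (k + l + 1)) ^ 2"
    by (simp only: power_mult mult.commute[of 2])
  finally show ?thesis by blast
qed

lemma mult_char_quad: "mult_char (quad_char :: 'a::finite_field \<Rightarrow> complex)"
  unfolding mult_char_def
proof (intro conjI allI)
  show "quad_char (0::'a) = 0" by (simp add: quad_char_def)
  have "\<exists>y::'a. 1 = y ^ 2" by (intro exI[of _ 1]) simp
  then show "quad_char (1::'a) = 1" by (simp add: quad_char_def)
  fix x y :: 'a
  have *: "(\<exists>z. x * y = z ^ 2) \<longleftrightarrow> (\<exists>z. y = z ^ 2)" if "x = a ^ 2" "a \<noteq> 0" for x y a :: 'a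
  proof
    assume "\<exists>z. x * y = z ^ 2"
    then obtain z where "x * y = z ^ 2" by blast
    then have "y = (z / a) ^ 2" using that by (simp add: power_divide field_simps)
    then show "\<exists>z. y = z ^ 2" by blast
  next
    assume "\<exists>z. y = z ^ 2"
    then show "\<exists>z. x * y = z ^ 2" using that by (metis power_mult_distrib)
  qed
  show "quad_char (x * y) = quad_char x * (quad_char y :: complex)"
  proof (cases "x = 0 \<or> y = 0")
    case False
    then show ?thesis
    proof (cases "\<exists>a. x = a ^ 2")
      case True
      then obtain a where "x = a ^ 2" "a \<noteq> 0" using False by auto
      then have "(\<exists>z. x * y = z ^ 2) \<longleftrightarrow> (\<exists>z. y = z ^ 2)" by (rule *)
      then show ?thesis using True False unfolding quad_char_def by simp
    next
      case x: False
      show ?thesis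
      proof (cases "\<exists>a. y = a ^ 2")
        case True
        then obtain a where "y = a ^ 2" "a \<noteq> 0" using False by auto
        then have "(\<exists>z. y * x = z ^ 2) \<longleftrightarrow> (\<exists>z. x = z ^ 2)" by (rule *)
        then show ?thesis using True False unfolding quad_char_def mult.commute[of x y] by simp
      next
        case False
        then show ?thesis using x nonsquare_mult_nonsquare[of x y] by (auto simp: quad_char_def)
      qed
    qed
  qed (auto simp: quad_char_def)
qed

lemma quad_char_neq_triv:
  assumes "(2::'a::finite_field) \<noteq> 0"
  shows "(quad_char :: 'a::finite_field \<Rightarrow> complex) \<noteq> triv_char"
proof -
  obtain c :: 'a where c: "\<nexists>y. c = y ^ 2" using ex_nonsquare[OF assms] by blast
  then have "c \<noteq> 0" by (metis power_zero_numeral)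
  then have "quad_char c \<noteq> (triv_char c :: complex)"
    using c by (simp add: quad_char_def triv_char_def)
  then show ?thesis by auto
qed

lemma quad_char_square: "quad_char * quad_char = (triv_char :: 'a::finite_field \<Rightarrow> complex)"
  by (auto simp: fun_eq_iff quad_char_def triv_char_def)

lemma inverse_quad_char: "inverse quad_char = (quad_char :: 'a::finite_field \<Rightarrow> complex)"
  by (auto simp: fun_eq_iff quad_char_def)

text \<open>Such a \<open>\<chi>\<close> is \<open>1\<close> on nonzero squares and
  \<open>- 1\<close> at some \<open>c\<close>, which is therefore a nonsquare; for any other
  nonsquare \<open>x\<close> the product \<open>c * x\<close> is a square.\<close>

lemma char_square_eq_triv:
  fixes \<chi> :: "'a::finite_field \<Rightarrow> complex"
  assumes "mult_char \<chi>" "\<chi> * \<chi> = triv_char" "\<chi> \<noteq> triv_char"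
  shows "\<chi> = quad_char"
proof
  have sq: "\<chi> x * \<chi> x = 1" if "x \<noteq> 0" for x
    using fun_cong[OF assms(2), of x] that by (simp add: triv_char_def)
  have square: "\<chi> (y ^ 2) = 1" if "y \<noteq> 0" for y
    using sq[OF that] by (simp add: mult_char_times[OF assms(1)] power2_eq_square)
  obtain c where "\<chi> c \<noteq> triv_char c" using assms(3) by auto
  then have c: "c \<noteq> 0" "\<chi> c \<noteq> 1"
    using mult_char_0[OF assms(1)] by (auto simp: triv_char_def split: if_splits)
  have "(\<chi> c - 1) * (\<chi> c + 1) = 0"
    using sq[OF c(1)] by (simp add: algebra_simps)
  with c have \<chi>c: "\<chi> c = - 1"
    by (auto simp: eq_neg_iff_add_eq_0)
  have c_nonsq: "\<nexists>y. c = y ^ 2"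
    using c square by (metis power_zero_numeral)
  fix x
  show "\<chi> x = quad_char x"
  proof (cases "x \<noteq> 0 \<and> (\<nexists>y. x = y ^ 2)")
    case True
    then obtain z where z: "c * x = z ^ 2" using nonsquare_mult_nonsquare[of c x] c_nonsq by blast
    then have "z \<noteq> 0" using True c by auto
    then have "\<chi> c * \<chi> x = 1" using square[of z] by (simp flip: z mult_char_times[OF assms(1)])
    then have "\<chi> x = - 1" using \<chi>c by (simp add: minus_equation_iff[of _ 1])
    then show ?thesis using True by (simp add: quad_char_def)
  next
    case False
    then consider "x = 0" | y where "y \<noteq> 0" "x = y ^ 2" by (metis power_zero_numeral)
    then show ?thesis
      using square mult_char_0[OF assms(1)] by cases (auto simp: quad_char_def)
  qed
qed

text \<open>The number of square roots of \<open>t\<close> is \<open>1 + quad_char t\<close>,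
  including \<open>t = 0\<close>.\<close>

lemma sum_square_arg:
  fixes f :: "'a::finite_field \<Rightarrow> complex"
  assumes "(2::'a) \<noteq> 0"
  shows "(\<Sum>y\<in>UNIV. f (y ^ 2)) = (\<Sum>t\<in>UNIV. (1 + quad_char t) * f t)"
proof -
  have "of_nat (card {y. y ^ 2 = t}) = (1 + quad_char t :: complex)" for t :: 'a
  proof (cases "\<exists>a. t = a ^ 2")
    case True
    then obtain a where a: "t = a ^ 2" by blast
    have "{y. y ^ 2 = t} = {a, - a}" by (auto simp: a power2_eq_iff)
    moreover have "a = - a \<longleftrightarrow> a = 0"
      using assms by (metis add.right_inverse mult_2 mult_eq_0_iff neg_equal_0_iff_equal)
    ultimately show ?thesis
      using True a by (cases "a = 0") (auto simp: quad_char_def)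
  next
    case False
    then have "{y. y ^ 2 = t} = {}" by auto
    moreover have "t \<noteq> 0" using False by (metis power_zero_numeral)
    moreover note False
    ultimately show ?thesis by (simp add: quad_char_def)
  qed
  then have "(\<Sum>t\<in>UNIV. (1 + quad_char t) * f t) = (\<Sum>t\<in>UNIV. \<Sum>y | y ^ 2 = t. f (y ^ 2))"
    by (intro sum.cong refl) (metis (mono_tags, lifting) mem_Collect_eq sum.cong sum_constant)
  also have "\<dots> = (\<Sum>y\<in>UNIV. f (y ^ 2))"
    using sum.group[of UNIV UNIV "\<lambda>y. y ^ 2" "\<lambda>y. f (y ^ 2)"] by simp
  finally show ?thesis ..
qed

text \<open>Completing the square: \<open>4 * x * (1 - x) = 1 - (2 * x - 1) ^ 2\<close>. This is the
  Jacobi sum form of the duplication formula.\<close>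

lemma jacobi_sum_same:
  fixes \<chi> :: "'a::finite_field \<Rightarrow> complex"
  assumes two: "(2::'a) \<noteq> 0" and \<chi>: "mult_char \<chi>" "\<chi> \<noteq> triv_char"
  shows "\<chi> 4 * jacobi_sum \<chi> \<chi> = jacobi_sum quad_char \<chi>"
proof -
  have "\<chi> 4 * jacobi_sum \<chi> \<chi> = (\<Sum>x\<in>UNIV. \<chi> (4 * (x * (1 - x))))"
    unfolding jacobi_sum_def by (simp add: mult_char_times[OF \<chi>(1)] sum_distrib_left)
  also have "\<dots> = (\<Sum>y\<in>UNIV. \<chi> (1 - y ^ 2))"
  proof (intro sum.reindex_bij_witness[of _ "\<lambda>y. (1 + y) / 2" "\<lambda>x. 2 * x - 1"])
    fix x :: 'a
    show "\<chi> (1 - (2 * x - 1) ^ 2) = \<chi> (4 * (x * (1 - x)))"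
      by (rule arg_cong[of _ _ \<chi>]) (simp add: power2_eq_square algebra_simps)
  qed (use two in \<open>auto simp: field_simps\<close>)
  also have "\<dots> = (\<Sum>t\<in>UNIV. (1 + quad_char t) * \<chi> (1 - t))"
    by (rule sum_square_arg[OF two])
  also have "\<dots> = (\<Sum>t\<in>UNIV. \<chi> (1 - t)) + jacobi_sum quad_char \<chi>"
    by (simp add: jacobi_sum_def algebra_simps sum.distrib)
  also have "(\<Sum>t\<in>UNIV. \<chi> (1 - t)) = 0"
    using \<chi> by (simp add: sum_UNIV_reflect sum_mult_char)
  finally show ?thesis by simp
qed

lemma (in additive_character) hasse_davenport_quadratic:
  assumes two: "(2::'a) \<noteq> 0" and \<chi>: "mult_char \<chi>"
  shows "G quad_char * G (\<chi> * \<chi>) = \<chi> 4 * G \<chi> * G (\<chi> * quad_char)"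
proof -
  consider "\<chi> = triv_char" | "\<chi> = quad_char" | "\<chi> * \<chi> \<noteq> triv_char"
    using char_square_eq_triv[OF \<chi>] by blast
  then show ?thesis
  proof cases
    case 1
    have "(4::'a) \<noteq> 0" using two by (metis mult_2 mult_eq_0_iff numeral_Bit0)
    then show ?thesis by (simp add: 1 triv_char_mult mult_char_triv mult_char_quad triv_char_def)
  next
    case 2
    have "(4::'a) = 2 ^ 2" by simp
    moreover have "(4::'a) \<noteq> 0" using two by (metis mult_2 mult_eq_0_iff numeral_Bit0)
    ultimately have "quad_char (4::'a) = 1" unfolding quad_char_def by metis
    then show ?thesis by (simp add: 2 quad_char_square)
  next
    case 3
    have "\<chi> \<noteq> triv_char" using 3 \<chi> by (auto simp: triv_char_mult)
    have "\<chi> * quad_char \<noteq> triv_char"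
    proof
      assume "\<chi> * quad_char = triv_char"
      then have "quad_char = inverse \<chi>" using \<chi> by (simp add: char_eq_inverse_iff mult_char_quad)
      then show False using 3 \<chi> by (metis inverse_char_inverse inverse_quad_char quad_char_square)
    qed
    \<comment> \<open>A further nonzero factor \<open>G \<chi>\<close> makes
      \<open>G \<chi> * G \<chi>\<close> available, which \<open>jacobi_sum_same\<close> relates to
      a Jacobi sum with \<open>quad_char\<close>.\<close>
    have "\<chi> 4 * G \<chi> * G (\<chi> * quad_char) * G \<chi> = \<chi> 4 * (G \<chi> * G \<chi>) * G (\<chi> * quad_char)"
      by (simp add: mult_ac)
    also have "\<dots> = (\<chi> 4 * jacobi_sum \<chi> \<chi>) * G (\<chi> * \<chi>) * G (\<chi> * quad_char)"
      using 3 \<chi> by (simp add: G_mult)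
    also have "\<dots> = (jacobi_sum quad_char \<chi> * G (quad_char * \<chi>)) * G (\<chi> * \<chi>)"
      using jacobi_sum_same[OF two \<chi> \<open>\<chi> \<noteq> triv_char\<close>] by (simp add: mult_ac)
    also have "\<dots> = G quad_char * G \<chi> * G (\<chi> * \<chi>)"
      using \<open>\<chi> * quad_char \<noteq> triv_char\<close> \<chi> by (simp add: G_mult mult_char_quad mult.commute[of quad_char])
    finally show ?thesis using G_nonzero[OF \<chi>] by (simp add: mult_ac)
  qed
qed

section \<open>The additive character\<close>

text \<open>The sum of all field elements is unchanged by adding \<open>1\<close> to each, so
  \<open>q\<close> is zero in the field and the characteristic divides \<open>p ^ r\<close>.\<close>

lemma prime_char_field:
  assumes "prime p" "CARD('a::finite_field) = p ^ r"
  shows "CHAR('a::finite_field) = p"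
proof -
  have "(\<Sum>x\<in>UNIV. x) = (\<Sum>x\<in>UNIV. 1 + (x::'a))"
    using sum_UNIV_shift[of "\<lambda>x. x" "1::'a"] by simp
  then have "of_nat CARD('a) = (0::'a)" by (simp add: sum.distrib)
  then have "CHAR('a) dvd p ^ r" using assms(2) by (simp only: of_nat_eq_0_iff_char_dvd)
  then have "CHAR('a) dvd p" using prime_dvd_power[OF CHAR_prime] by blast
  then show ?thesis using assms(1) primes_dvd_imp_eq[OF CHAR_prime] by blast
qed

lemma of_nat_eq_iff_mod:
  "(of_nat m :: 'a::finite_field) = of_nat n \<longleftrightarrow> m mod CHAR('a) = n mod CHAR('a)"
  by (simp add: of_nat_eq_iff_cong_CHAR cong_def)

text \<open>Frobenius permutes the summands cyclically because \<open>x ^ (p ^ r) = x\<close>; this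
  is why the trace lies in the prime field.\<close>

lemma field_trace_frobenius:
  fixes x :: "'a::finite_field"
  assumes "prime p" "CARD('a) = p ^ r"
  shows "field_trace p r x ^ p = field_trace p r x"
proof -
  have p: "p = CHAR('a)" using prime_char_field[OF assms] by simp
  have "field_trace p r x ^ p = (\<Sum>i<r. (x ^ (p ^ i)) ^ p)"
    unfolding field_trace_def using p by (intro freshmans_dream_sum) auto
  also have "\<dots> = (\<Sum>i<r. x ^ (p ^ Suc i))"
    by (simp add: mult.commute flip: power_mult)
  also have "\<dots> = (\<Sum>i<Suc r. x ^ (p ^ i)) - x"
    by (subst sum.lessThan_Suc_shift) simp
  also have "\<dots> = field_trace p r x"
    using finite_field_power_card_eq_same[of x] assms(2) by (simp add: field_trace_def)
  finally show ?thesis .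
qed

text \<open>The polynomial \<open>X ^ p - X\<close> has at most \<open>p\<close> roots, and the
  \<open>p\<close> multiples of \<open>1\<close> already are roots.\<close>

lemma finite_field_frobenius_fixed:
  fixes x :: "'a::finite_field"
  assumes "x ^ CHAR('a) = x"
  shows "\<exists>k<CHAR('a). of_nat k = x"
proof -
  define p where "p = CHAR('a)"
  have p: "prime p" by (simp add: p_def)
  have k_p: "(of_nat k :: 'a) ^ p = of_nat k" for k
  proof (induction k)
    case 0 then show ?case using p by (simp add: prime_gt_0_nat)
  next
    case (Suc k) then show ?case using freshmans_dream[of p "1::'a" "of_nat k"] p by (simp add: p_def)
  qed
  define f :: "'a poly" where "f = Polynomial.monom 1 p - Polynomial.monom 1 1"
  have "p > 1" using p by (rule prime_gt_1_nat)
  then have "Polynomial.coeff f p = 1" by (simp add: f_def)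
  then have "f \<noteq> 0" by auto
  have "degree f \<le> p" unfolding f_def
    using \<open>p > 1\<close> by (intro degree_diff_le) (auto simp: degree_monom_eq)
  have roots: "{y. poly f y = 0} = {y. y ^ p = y}"
    by (auto simp: f_def poly_monom)
  have "card {y::'a. y ^ p = y} \<le> p"
    using card_poly_roots_bound[OF \<open>f \<noteq> 0\<close>] \<open>degree f \<le> p\<close> unfolding roots by linarith
  moreover have "card ((of_nat :: nat \<Rightarrow> 'a) ` {..<p}) = p"
    by (subst card_image) (auto simp: inj_on_def of_nat_eq_iff_mod p_def)
  moreover have "(of_nat :: nat \<Rightarrow> 'a) ` {..<p} \<subseteq> {y. y ^ p = y}"
    using k_p by auto
  ultimately have "(of_nat :: nat \<Rightarrow> 'a) ` {..<p} = {y. y ^ p = y}"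
    using card_seteq[of "{y::'a. y ^ p = y}" "of_nat ` {..<p}"] by simp
  then have "x \<in> (of_nat :: nat \<Rightarrow> 'a) ` {..<p}" using assms by (simp add: p_def)
  then show ?thesis by (auto simp: p_def)
qed

text \<open>The trace is a nonzero polynomial function of degree at most \<open>p ^ (r - 1)\<close>,
  too small to vanish on all \<open>p ^ r\<close> elements.\<close>

lemma ex_field_trace_nonzero:
  assumes "prime p" "CARD('a::finite_field) = p ^ r"
  obtains x :: "'a::finite_field" where "field_trace p r x \<noteq> 0"
proof (rule ccontr)
  assume "\<not> thesis"
  with that have 0: "field_trace p r x = 0" for x :: 'a by blast
  define f :: "'a poly" where "f = (\<Sum>i<r. Polynomial.monom 1 (p ^ i))"
  have "p > 1" using assms(1) by (rule prime_gt_1_nat)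
  have "r > 0"
  proof (rule ccontr)
    assume "\<not> r > 0"
    then have "CARD('a) = 1" using assms(2) by simp
    then have "(0::'a) = 1" by (metis UNIV_I card_1_singletonE singletonD)
    then show False by simp
  qed
  have inj: "p ^ i = p ^ j \<longleftrightarrow> i = j" for i j using \<open>p > 1\<close> by simp
  have "Polynomial.coeff f (p ^ (r - 1)) = (\<Sum>i<r. if i = r - 1 then 1 else 0)"
    unfolding f_def coeff_sum by (intro sum.cong) (auto simp: inj)
  also have "\<dots> = 1" using \<open>r > 0\<close> by simp
  finally have "f \<noteq> 0" by auto
  have "degree f \<le> p ^ (r - 1)" unfolding f_def
    using \<open>p > 1\<close> by (intro degree_sum_le) (auto simp: degree_monom_eq intro!: power_increasing)
  moreover have "{x. poly f x = 0} = UNIV"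
    using 0 by (auto simp: f_def poly_sum poly_monom field_trace_def)
  ultimately have "p ^ r \<le> p ^ (r - 1)"
    using card_poly_roots_bound[OF \<open>f \<noteq> 0\<close>] assms(2) by simp
  moreover have "p ^ (r - 1) < p ^ r" using \<open>p > 1\<close> \<open>r > 0\<close> by (intro power_strict_increasing) auto
  ultimately show False by simp
qed

lemma additive_character_add_char:
  assumes p: "prime p" "CARD('a::finite_field) = p ^ r" and \<zeta>: "primitive_root_of_unity p \<zeta>"
  shows "additive_character (add_char p r \<zeta> :: 'a::finite_field \<Rightarrow> complex)"
proof -
  have char: "CHAR('a) = p" using p by (rule prime_char_field)
  have p0: "p > 0" using p by (simp add: prime_gt_0_nat)
  define \<tau> where "\<tau> = (\<lambda>x::'a. THE k. k < p \<and> of_nat k = field_trace p r x)"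
  have \<tau>: "\<tau> x < p \<and> of_nat (\<tau> x) = field_trace p r x" for x
    unfolding \<tau>_def
  proof (rule theI')
    obtain k where "k < p" "of_nat k = field_trace p r x"
      using finite_field_frobenius_fixed[of "field_trace p r x"] field_trace_frobenius[OF p, of x] char
      by auto
    then show "\<exists>!k. k < p \<and> of_nat k = field_trace p r x"
      using of_nat_eq_iff_mod[where 'a = 'a] char by (metis mod_less)
  qed
  have add_char: "add_char p r \<zeta> x = \<zeta> ^ \<tau> x" for x
    by (simp add: add_char_def \<tau>_def)
  have \<zeta>p: "\<zeta> ^ p = 1" using \<zeta> by (simp add: primitive_root_of_unity_def)
  have \<zeta>_mod: "\<zeta> ^ (i mod p) = \<zeta> ^ i" for i
  proof -
    have "\<zeta> ^ i = \<zeta> ^ (p * (i div p) + i mod p)" by simp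
    also have "\<dots> = \<zeta> ^ (i mod p)" by (simp only: power_add power_mult \<zeta>p) simp
    finally show ?thesis ..
  qed
  have trace_add: "field_trace p r (x + y) = field_trace p r x + field_trace p r y" for x y :: 'a
    unfolding field_trace_def sum.distrib[symmetric]
    using p(1) by (intro sum.cong refl freshmans_dream') (simp_all add: char)
  have add: "add_char p r \<zeta> (x + y) = add_char p r \<zeta> x * add_char p r \<zeta> y" for x y :: 'a
  proof -
    have "of_nat (\<tau> (x + y)) = (of_nat (\<tau> x + \<tau> y) :: 'a)"
      using \<tau> trace_add by simp
    then have "\<tau> (x + y) mod p = (\<tau> x + \<tau> y) mod p"
      by (simp only: of_nat_eq_iff_mod char)
    then have "\<zeta> ^ \<tau> (x + y) = \<zeta> ^ (\<tau> x + \<tau> y)"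
      by (metis \<zeta>_mod)
    then show ?thesis by (simp add: add_char power_add)
  qed
  obtain c :: 'a where "field_trace p r c \<noteq> 0"
    using ex_field_trace_nonzero[OF p] by blast
  \<comment> \<open>Here \<open>0 < \<tau> c < p\<close>, so primitivity of \<open>\<zeta>\<close>
    makes the character nontrivial at \<open>c\<close>; translation by \<open>c\<close> then kills
    the full sum.\<close>
  then have "\<tau> c \<noteq> 0" using \<tau>[of c] by (cases "\<tau> c = 0") auto
  then have "add_char p r \<zeta> c \<noteq> 1"
    using \<zeta> \<tau>[of c] by (simp add: primitive_root_of_unity_def add_char)
  moreover have "(\<Sum>x\<in>(UNIV::'a set). add_char p r \<zeta> x) = (\<Sum>x\<in>(UNIV::'a set). add_char p r \<zeta> (c + x))"
    by (rule sum_UNIV_shift[symmetric])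
  then have "(\<Sum>x\<in>(UNIV::'a set). add_char p r \<zeta> x) = add_char p r \<zeta> c * (\<Sum>x\<in>(UNIV::'a set). add_char p r \<zeta> x)"
    unfolding add sum_distrib_left .
  ultimately have sum_0: "(\<Sum>x\<in>(UNIV::'a set). add_char p r \<zeta> x) = 0"
    by (simp add: algebra_simps)
  have "field_trace p r (0::'a) = 0" using p0 by (simp add: field_trace_def power_0_left)
  then have "\<tau> 0 mod p = 0 mod p"
    using \<tau>[of 0] of_nat_eq_iff_mod[of "\<tau> 0" 0, where 'a = 'a] char by simp
  then have "add_char p r \<zeta> (0::'a) = 1"
    using \<tau>[of 0] by (simp add: add_char)
  with add sum_0 show ?thesis by unfold_locales
qed

section \<open>The birational transformation\<close>

text \<open>The map \<open>(1 - y) / (y + 2)\<close> has determinant \<open>-3\<close> and misses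
  the value \<open>- 1\<close>. In characteristic 3 it is constantly \<open>- 1\<close> off its
  pole; the condition \<open>p \<noteq> 3\<close> enters through this lemma.\<close>

lemma sum_mobius_char:
  fixes B :: "'a::finite_field \<Rightarrow> complex"
  assumes B: "mult_char B" "B \<noteq> triv_char" and three: "(3::'a) \<noteq> 0"
  shows "(\<Sum>y\<in>UNIV. B ((1 - y) / (y + 2))) = - B (- 1)"
proof -
  have "(\<Sum>y\<in>UNIV. B ((1 - y) / (y + 2))) = (\<Sum>y\<in>UNIV - {- 2}. B ((1 - y) / (y + 2)))"
    using mult_char_0[OF B(1)] by (intro sum.mono_neutral_right) auto
  also have "\<dots> = (\<Sum>x\<in>UNIV - {- 1}. B x)"
  proof (intro sum.reindex_bij_witness[of _ "\<lambda>x. 3 / (x + 1) - 2" "\<lambda>y. (1 - y) / (y + 2)"])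
    fix y :: 'a assume "y \<in> UNIV - {- 2}"
    then have y: "y + 2 \<noteq> 0" by (auto simp: eq_neg_iff_add_eq_0)
    then have *: "(1 - y) / (y + 2) + 1 = 3 / (y + 2)" by (simp add: field_simps)
    have **: "3 / (3 / (y + 2)) = y + 2" using three by simp
    show "3 / ((1 - y) / (y + 2) + 1) - 2 = y" unfolding * ** by simp
    show "(1 - y) / (y + 2) \<in> UNIV - {- 1}" using * y three by (auto simp: add_eq_0_iff)
  next
    fix x :: 'a assume "x \<in> UNIV - {- 1}"
    then have x: "x + 1 \<noteq> 0" by (auto simp: eq_neg_iff_add_eq_0)
    then have *: "1 - (3 / (x + 1) - 2) = 3 * x / (x + 1)" by (simp add: field_simps)
    show "(1 - (3 / (x + 1) - 2)) / (3 / (x + 1) - 2 + 2) = x" unfolding * using three x by simp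
    show "3 / (x + 1) - 2 \<in> UNIV - {- 2}" using three x by auto
  qed auto
  also have "\<dots> = - B (- 1)"
    using B by (subst sum_diff1) (auto simp: sum_mult_char)
  finally show ?thesis .
qed

text \<open>Since \<open>a / b = y (1 + y) / (z (1 + z))\<close>, only the factors
  \<open>y - 1\<close> and \<open>z - 1\<close> of the cubics remain, and their ratio becomes
  \<open>(a - a b + 2) / (b - a b + 2)\<close>. Division by zero gives zero and
  \<open>B 0 = 0\<close>, so poles contribute nothing.\<close>

lemma cubic_product_birational:
  fixes B :: "'a::finite_field \<Rightarrow> complex"
  assumes B: "mult_char B" "B (- 1) = 1" "B \<noteq> triv_char" "B ^ 3 \<noteq> triv_char"
    and two: "(2::'a) \<noteq> 0" and three: "(3::'a) \<noteq> 0"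
  shows "(\<Sum>y\<in>UNIV. B (y ^ 3 - y)) * (\<Sum>z\<in>UNIV. inverse B (z ^ 3 - z)) =
    (\<Sum>a\<in>UNIV. \<Sum>b\<in>UNIV. B (a * (a - a * b + 2) / (b * (b - a * b + 2))))"
proof -
  note B0 = mult_char_0[OF B(1)]
  define F where "F = (\<lambda>(y, z). B ((y ^ 3 - y) / (z ^ 3 - z)))"
  define H where "H = (\<lambda>(a, b). B (a * (a - a * b + 2) / (b * (b - a * b + 2))))"
  \<comment> \<open>\<open>D1\<close> and \<open>D2\<close> correspond bijectively. The line
    \<open>E1\<close> is contracted to the point \<open>(-1, -1)\<close>, where the new summand
    vanishes; \<open>E2a\<close>, \<open>E2b\<close> and \<open>E2c\<close> lie outside the image of
    \<open>D1\<close>.\<close>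
  define D1 where "D1 = {(y, z). y \<noteq> 0 \<and> z \<noteq> 0 \<and> y \<noteq> - 1 \<and> z \<noteq> - 1 \<and> y + z + 1 \<noteq> (0::'a)}"
  define E1 where "E1 = (\<lambda>y. (y, - 1 - y)) ` (UNIV - {0, - 1 :: 'a})"
  define D2 where "D2 = {(a, b). a \<noteq> 0 \<and> b \<noteq> 0 \<and> a \<noteq> - 1 \<and> b \<noteq> - 1 \<and> a * b \<noteq> (1::'a)}"
  define E2a where "E2a = (\<lambda>b::'a. (- 1 :: 'a, b)) ` (UNIV - {- 1})"
  define E2b where "E2b = (\<lambda>a::'a. (a, - 1 :: 'a)) ` (UNIV - {- 1})"
  define E2c where "E2c = (\<lambda>a. (a, 1 / a)) ` (UNIV - {0, - 1 :: 'a})"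

  have "sum F D1 = sum H D2"
  proof (intro sum.reindex_bij_witness[of _ "\<lambda>(a, b). ((1 + a) / (a * b - 1), (1 + b) / (a * b - 1))"
        "\<lambda>(y, z). ((1 + y) / z, (1 + z) / y)"])
    fix p assume "p \<in> D1"
    then obtain y z where p: "p = (y, z)" and nz: "y \<noteq> 0" "z \<noteq> 0" "1 + y \<noteq> 0" "1 + z \<noteq> 0" "y + z + 1 \<noteq> 0"
      by (auto simp: D1_def add_eq_0_iff)
    have ab: "(1 + y) / z * ((1 + z) / y) - 1 = (y + z + 1) / (y * z)"
      using nz by (simp add: field_simps)
    have a1: "1 + (1 + y) / z = (y + z + 1) / z" "1 + (1 + z) / y = (y + z + 1) / y"
      using nz by (simp_all add: field_simps)
    show "(case case p of (y, z) \<Rightarrow> ((1 + y) / z, (1 + z) / y) of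
        (a, b) \<Rightarrow> ((1 + a) / (a * b - 1), (1 + b) / (a * b - 1))) = p"
      unfolding p split ab a1 using nz by simp
    have "(1 + y) / z \<noteq> - 1" "(1 + z) / y \<noteq> - 1"
      using a1 nz by (auto simp: eq_neg_iff_add_eq_0 add.commute)
    moreover have "(1 + y) / z * ((1 + z) / y) \<noteq> 1" using ab nz by auto
    ultimately show "(case p of (y, z) \<Rightarrow> ((1 + y) / z, (1 + z) / y)) \<in> D2"
      unfolding p D2_def split mem_Collect_eq using nz by (intro conjI) auto
    have 1: "(1 + y) / z - (1 + y) / z * ((1 + z) / y) + 2 = (y - 1) * (y + z + 1) / (y * z)"
      and 2: "(1 + z) / y - (1 + y) / z * ((1 + z) / y) + 2 = (z - 1) * (y + z + 1) / (y * z)"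
      using nz by (simp_all add: field_simps)
    have "(1 + y) / z * ((y - 1) * (y + z + 1) / (y * z)) /
        ((1 + z) / y * ((z - 1) * (y + z + 1) / (y * z))) = (y ^ 3 - y) / (z ^ 3 - z)"
    proof (cases "z = 1")
      case False
      then have "z - 1 \<noteq> 0" by simp
      moreover have "y ^ 3 - y = y * (1 + y) * (y - 1)" "z ^ 3 - z = z * (1 + z) * (z - 1)"
        by (simp_all add: power3_eq_cube algebra_simps)
      ultimately show ?thesis using nz by (simp add: mult_ac)
    qed simp
    then show "H (case p of (y, z) \<Rightarrow> ((1 + y) / z, (1 + z) / y)) = F p"
      unfolding p H_def F_def split 1 2 by simp
  next
    fix p assume "p \<in> D2"
    then obtain a b where p: "p = (a, b)" and nz: "a \<noteq> 0" "b \<noteq> 0" "1 + a \<noteq> 0" "1 + b \<noteq> 0" "a * b - 1 \<noteq> 0"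
      by (auto simp: D2_def add_eq_0_iff)
    have y1: "1 + (1 + a) / (a * b - 1) = a * (1 + b) / (a * b - 1)"
      and z1: "1 + (1 + b) / (a * b - 1) = b * (1 + a) / (a * b - 1)"
      using nz by (simp_all add: field_simps)
    have "(1 + a) / (a * b - 1) + (1 + b) / (a * b - 1) + 1 = (1 + a + (1 + b) + (a * b - 1)) / (a * b - 1)"
      using nz(5) by (simp only: add_divide_distrib divide_self simp_thms)
    also have "1 + a + (1 + b) + (a * b - 1) = (1 + a) * (1 + b)" by (simp add: algebra_simps)
    finally have yz: "(1 + a) / (a * b - 1) + (1 + b) / (a * b - 1) + 1 = (1 + a) * (1 + b) / (a * b - 1)" .
    show "(case case p of (a, b) \<Rightarrow> ((1 + a) / (a * b - 1), (1 + b) / (a * b - 1)) of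
        (y, z) \<Rightarrow> ((1 + y) / z, (1 + z) / y)) = p"
      unfolding p split y1 z1 using nz by simp
    have "(1 + a) / (a * b - 1) \<noteq> - 1" "(1 + b) / (a * b - 1) \<noteq> - 1"
      using y1 z1 nz by (auto simp: eq_neg_iff_add_eq_0 add.commute)
    then show "(case p of (a, b) \<Rightarrow> ((1 + a) / (a * b - 1), (1 + b) / (a * b - 1))) \<in> D1"
      unfolding p D1_def split mem_Collect_eq yz using nz by simp
  qed

  \<comment> \<open>The cubics share the factor \<open>y (y + 1)\<close> on this line. The excluded
    points \<open>y = 0\<close> and \<open>y = - 1\<close> account for \<open>B (1 / 2)\<close> and
    \<open>B 2\<close>.\<close>
  moreover have "sum F E1 = - 1 - B (1 / 2) - B 2"
  proof -
    have "sum F E1 = (\<Sum>y\<in>UNIV - {0, - 1}. B ((1 - y) / (y + 2)))"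
      unfolding E1_def
    proof (subst sum.reindex, force simp: inj_on_def, rule sum.cong[OF refl])
      fix y :: 'a assume "y \<in> UNIV - {0, - 1}"
      then have y: "y \<noteq> 0" "y + 1 \<noteq> 0" by (auto simp: eq_neg_iff_add_eq_0)
      have "y ^ 3 - y = (y * (y + 1)) * (y - 1)"
        and "(- 1 - y) ^ 3 - (- 1 - y) = (y * (y + 1)) * - (y + 2)"
        by (simp_all add: power3_eq_cube algebra_simps)
      then have "(y ^ 3 - y) / ((- 1 - y) ^ 3 - (- 1 - y)) = (y - 1) / - (y + 2)"
        using y by (simp only:) (subst nonzero_mult_divide_mult_cancel_left; simp)
      also have "\<dots> = (1 - y) / (y + 2)" by (metis minus_diff_eq minus_divide_left minus_divide_right)
      finally show "(F \<circ> (\<lambda>y. (y, - 1 - y))) y = B ((1 - y) / (y + 2))" by (simp add: F_def)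
    qed
    also have "\<dots> = (\<Sum>y\<in>UNIV. B ((1 - y) / (y + 2))) - (\<Sum>y\<in>{0, - 1}. B ((1 - y) / (y + 2)))"
      by (intro sum_diff) auto
    also have "\<dots> = - 1 - B (1 / 2) - B 2"
      using B three by (simp add: sum_mobius_char)
    finally show ?thesis .
  qed

  \<comment> \<open>For \<open>a = - 1\<close> the factor \<open>1 + b\<close> cancels and
    \<open>- 1 / (2 * b)\<close> remains; a full character sum then lacks only
    \<open>b = - 1\<close>. The line \<open>b = - 1\<close> is analogous.\<close>
  moreover have "sum H E2a = - B (1 / 2)"
  proof -
    have "sum H E2a = (\<Sum>b\<in>UNIV - {- 1}. inverse B (- 2 * b))"
      unfolding E2a_def
    proof (subst sum.reindex, force simp: inj_on_def, rule sum.cong[OF refl])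
      fix b :: 'a assume "b \<in> UNIV - {- 1}"
      then have b: "1 + b \<noteq> 0" by (auto simp: add_eq_0_iff)
      have "- 1 * (- 1 - - 1 * b + 2) = (1 + b) * - 1" "b * (b - - 1 * b + 2) = (1 + b) * (2 * b)"
        by (simp_all add: algebra_simps)
      then have "- 1 * (- 1 - - 1 * b + 2) / (b * (b - - 1 * b + 2)) = - 1 / (2 * b)"
        using nonzero_mult_divide_mult_cancel_left[OF b, of "- 1" "2 * b"] by (simp only:)
      also have "\<dots> = inverse (- 2 * b)" unfolding inverse_eq_divide by simp
      finally show "(H \<circ> Pair (- 1)) b = inverse B (- 2 * b)"
        by (simp only: H_def o_def split mult_char_inverse_arg[OF B(1)] inverse_fun_apply)
    qed
    also have "\<dots> = (\<Sum>b\<in>UNIV. inverse B (- 2 * b)) - inverse B 2"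
      by (subst sum_diff1) auto
    also have "(\<Sum>b\<in>UNIV. inverse B (- 2 * b)) = (\<Sum>b\<in>UNIV. inverse B b)"
      using two by (intro sum_UNIV_scale) simp
    also have "\<dots> = 0"
      using B by (simp add: sum_mult_char[OF mult_char_inverse] inverse_char_eq_triv_iff del: inverse_fun_apply)
    finally have "sum H E2a = 0 - inverse (B 2)" by (simp only: inverse_fun_apply)
    moreover have "B (1 / 2) = inverse (B 2)"
      by (simp only: divide_inverse mult_1_left mult_char_inverse_arg[OF B(1)])
    ultimately show ?thesis by simp
  qed

  moreover have "sum H E2b = - B 2"
  proof -
    have "sum H E2b = (\<Sum>a\<in>UNIV - {- 1}. B (- 2 * a))"
      unfolding E2b_def
    proof (subst sum.reindex, force simp: inj_on_def, rule sum.cong[OF refl])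
      fix a :: 'a assume "a \<in> UNIV - {- 1}"
      then have a: "1 + a \<noteq> 0" by (auto simp: add_eq_0_iff)
      have "a * (a - a * - 1 + 2) = (1 + a) * (2 * a)" "- 1 * (- 1 - a * - 1 + 2) = (1 + a) * - 1"
        by (simp_all add: algebra_simps)
      then have "a * (a - a * - 1 + 2) / (- 1 * (- 1 - a * - 1 + 2)) = - 2 * a"
        using nonzero_mult_divide_mult_cancel_left[OF a, of "2 * a" "- 1"] by (simp only:) simp
      then show "(H \<circ> (\<lambda>a. (a, - 1))) a = B (- 2 * a)"
        by (simp add: H_def)
    qed
    also have "\<dots> = (\<Sum>a\<in>UNIV. B (- 2 * a)) - B 2"
      by (subst sum_diff1) auto
    also have "(\<Sum>a\<in>UNIV. B (- 2 * a)) = (\<Sum>a\<in>UNIV. B a)"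
      using two by (intro sum_UNIV_scale) simp
    finally show ?thesis using B by (simp add: sum_mult_char)
  qed

  \<comment> \<open>For \<open>a b = 1\<close> the argument is \<open>a ^ 3\<close>. The full sum
    vanishes since \<open>B ^ 3\<close> is nontrivial, and the excluded \<open>a = - 1\<close>
    contributes \<open>1\<close>.\<close>
  moreover have "sum H E2c = - 1"
  proof -
    have "sum H E2c = (\<Sum>a\<in>UNIV - {0, - 1}. (B ^ 3) a)"
      unfolding E2c_def
    proof (subst sum.reindex, force simp: inj_on_def, rule sum.cong[OF refl])
      fix a :: 'a assume "a \<in> UNIV - {0, - 1}"
      then have a: "a \<noteq> 0" "1 + a \<noteq> 0" by (auto simp: add_eq_0_iff)
      have 1: "a - a * (1 / a) + 2 = 1 + a" "1 / a - a * (1 / a) + 2 = (1 + a) / a"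
        using a by (simp_all add: field_simps)
      have "a * (1 + a) / (1 / a * ((1 + a) / a)) = a ^ 3"
        using a by (simp add: power3_eq_cube)
      then show "(H \<circ> (\<lambda>a. (a, 1 / a))) a = (B ^ 3) a"
        by (simp only: H_def o_def split 1 fun_power_apply mult_char_power[OF B(1)])
    qed
    also have "\<dots> = (\<Sum>a\<in>UNIV. (B ^ 3) a) - (\<Sum>a\<in>{0, - 1}. (B ^ 3) a)"
      by (intro sum_diff) auto
    also have "\<dots> = - 1"
      unfolding sum_mult_char[OF mult_char_power_char[OF B(1), of 3, simplified]]
      using B by (simp add: fun_power_apply B0)
    finally show ?thesis .
  qed

  moreover have "sum F UNIV = sum F D1 + sum F E1"
  proof -
    have "sum F UNIV = sum F (D1 \<union> E1)"
    proof (intro sum.mono_neutral_right ballI)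
      fix p assume "p \<in> UNIV - (D1 \<union> E1)"
      then obtain y z where p: "p = (y, z)" and "(y, z) \<notin> D1" "(y, z) \<notin> E1"
        by (cases p) auto
      then have "y = 0 \<or> y = - 1 \<or> z = 0 \<or> z = - 1"
        by (auto simp: D1_def E1_def image_iff algebra_simps eq_neg_iff_add_eq_0)
      then show "F p = 0" using B0 by (auto simp: p F_def)
    qed auto
    also have "\<dots> = sum F D1 + sum F E1"
      by (intro sum.union_disjoint) (auto simp: D1_def E1_def)
    finally show ?thesis .
  qed

  moreover have "sum H UNIV = sum H D2 + sum H E2a + sum H E2b + sum H E2c"
  proof -
    have "sum H UNIV = sum H (D2 \<union> E2a \<union> E2b \<union> E2c)"
    proof (intro sum.mono_neutral_right ballI)
      fix p assume "p \<in> UNIV - (D2 \<union> E2a \<union> E2b \<union> E2c)"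
      then obtain a b where p: "p = (a, b)" and
        *: "(a, b) \<notin> D2" "(a, b) \<notin> E2a" "(a, b) \<notin> E2b" "(a, b) \<notin> E2c"
        by (cases p) auto
      \<comment> \<open>Besides the axes only \<open>(-1, -1)\<close> is left uncovered, and there
        \<open>a - a * b + 2 = 0\<close>.\<close>
      have "a = - 1 \<longleftrightarrow> b = - 1" using *(2,3) by (auto simp: E2a_def E2b_def)
      moreover have "a = 0 \<or> a = - 1 \<or> a * b \<noteq> 1" using *(4) by (auto simp: E2c_def field_simps)
      ultimately have "a = 0 \<or> b = 0 \<or> a = - 1 \<and> b = - 1"
        using *(1) by (auto simp: D2_def)
      then show "H p = 0" using B0 by (auto simp: p H_def)
    qed auto
    also have "\<dots> = sum H (D2 \<union> E2a \<union> E2b) + sum H E2c"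
      by (intro sum.union_disjoint) (auto simp: D2_def E2a_def E2b_def E2c_def minus_equation_iff[of _ 1] field_simps)
    also have "sum H (D2 \<union> E2a \<union> E2b) = sum H (D2 \<union> E2a) + sum H E2b"
      by (intro sum.union_disjoint) (auto simp: D2_def E2a_def E2b_def)
    also have "sum H (D2 \<union> E2a) = sum H D2 + sum H E2a"
      by (intro sum.union_disjoint) (auto simp: D2_def E2a_def)
    finally show ?thesis .
  qed

  moreover have "(\<Sum>y\<in>UNIV. B (y ^ 3 - y)) * (\<Sum>z\<in>UNIV. inverse B (z ^ 3 - z)) = sum F UNIV"
    by (simp add: F_def sum_product sum.cartesian_product mult_char_divide[OF B(1)])
      (simp add: divide_inverse)
  moreover have "sum H UNIV = (\<Sum>a\<in>UNIV. \<Sum>b\<in>UNIV. B (a * (a - a * b + 2) / (b * (b - a * b + 2))))"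
    by (simp add: H_def sum.cartesian_product)
  ultimately show ?thesis by simp
qed

section \<open>Expansion of the double sum in additive and then in multiplicative characters\<close>

context additive_character
begin

text \<open>
  Both sides arise from the same four-fold sum over \<open>s\<close>, \<open>t\<close>, \<open>b\<close> and \<open>a\<close> or \<open>c\<close> when \<open>B\<close> and its
  inverse are expanded in additive characters; the substitution is \<open>a t = s c\<close>.
\<close>

lemma double_sum_transform:
  fixes B :: "'a \<Rightarrow> complex"
  assumes B: "mult_char B" "B \<noteq> triv_char"
  shows "(\<Sum>a\<in>UNIV. \<Sum>b\<in>UNIV. B ((a / b) ^ 2) * B (1 + b + x / a) * inverse B (1 + a + y / b)) =
    (\<Sum>c\<in>UNIV. \<Sum>b\<in>UNIV. B ((c / b) ^ 2) * inverse B (1 + b + c) * B (1 + x / c + y / b))"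
    (is "?L = ?R")
proof -
  note times = mult_char_times[OF B(1)] and divide = mult_char_divide[OF B(1)]
    and power = mult_char_power[OF B(1)] and zero_iff = mult_char_eq_0_iff[OF B(1)]
  have iB: "mult_char (inverse B)" "inverse B \<noteq> triv_char"
    using B by (simp_all add: mult_char_inverse inverse_char_eq_triv_iff)
  have expand: "B w * G (inverse B) = (\<Sum>s\<in>UNIV. inverse B s * \<theta> (w * s))"
    and expand': "inverse B w * G B = (\<Sum>t\<in>UNIV. B t * \<theta> (w * t))" for w
    using G_scale[of "inverse B" w] G_scale[of B w] B iB by simp_all
  let ?K = "\<lambda>a b. B ((a / b) ^ 2)"
  have "?L * (G (inverse B) * G B) = (\<Sum>a\<in>UNIV. \<Sum>b\<in>UNIV. ?K a b *
      (B (1 + b + x / a) * G (inverse B)) * (inverse B (1 + a + y / b) * G B))"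
    unfolding sum_distrib_right by (simp add: mult_ac)
  also have "\<dots> = (\<Sum>a\<in>UNIV. \<Sum>b\<in>UNIV. \<Sum>s\<in>UNIV. \<Sum>t\<in>UNIV. ?K a b *
      (inverse B s * \<theta> ((1 + b + x / a) * s)) * (B t * \<theta> ((1 + a + y / b) * t)))"
    by (simp only: expand expand', simp only: mult.assoc sum_product, simp only: sum_distrib_left)
  also have "\<dots> = (\<Sum>s\<in>UNIV. \<Sum>t\<in>UNIV. \<Sum>b\<in>UNIV. \<Sum>a\<in>UNIV. ?K a b *
      (inverse B s * \<theta> ((1 + b + x / a) * s)) * (B t * \<theta> ((1 + a + y / b) * t)))"
    unfolding sum.cartesian_product
    by (intro sum.reindex_bij_witness[of _ "\<lambda>(s, t, b, a). (a, b, s, t)" "\<lambda>(a, b, s, t). (s, t, b, a)"])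
      auto
  also have "\<dots> = (\<Sum>s\<in>UNIV. \<Sum>t\<in>UNIV. \<Sum>b\<in>UNIV. \<Sum>c\<in>UNIV. ?K c b *
      (B s * \<theta> ((1 + b + c) * s)) * (inverse B t * \<theta> ((1 + x / c + y / b) * t)))"
  proof (rule sum.cong[OF refl], rule sum.cong[OF refl], rule sum.cong[OF refl])
    fix s t b :: 'a
    let ?f = "\<lambda>a. ?K a b * (inverse B s * \<theta> ((1 + b + x / a) * s)) * (B t * \<theta> ((1 + a + y / b) * t))"
    show "(\<Sum>a\<in>UNIV. ?f a) = (\<Sum>c\<in>UNIV. ?K c b *
      (B s * \<theta> ((1 + b + c) * s)) * (inverse B t * \<theta> ((1 + x / c + y / b) * t)))"
    proof (cases "s = 0 \<or> t = 0")
      case False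
      then have "(\<Sum>a\<in>UNIV. ?f a) = (\<Sum>c\<in>UNIV. ?f (s / t * c))"
        by (intro sum_UNIV_scale[symmetric]) simp
      also have "\<dots> = (\<Sum>c\<in>UNIV. ?K c b *
        (B s * \<theta> ((1 + b + c) * s)) * (inverse B t * \<theta> ((1 + x / c + y / b) * t)))"
      proof (rule sum.cong[OF refl])
        fix c :: 'a
        show "?f (s / t * c) = ?K c b *
          (B s * \<theta> ((1 + b + c) * s)) * (inverse B t * \<theta> ((1 + x / c + y / b) * t))"
        proof (cases "c = 0 \<or> b = 0")
          case True
          then show ?thesis using zero_iff[of 0] by auto
        next
          case nz: False
          \<comment> \<open>The exponent \<open>2\<close> in the weight matters here: it supplies
            \<open>B (s / t) ^ 2\<close>, which exchanges \<open>B\<close> and its inverse on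
            \<open>s\<close> and \<open>t\<close>.\<close>
          have "?K (s / t * c) b * inverse B s * B t = ?K c b * B s * inverse B t"
            using False by (simp add: times divide power zero_iff field_simps power2_eq_square)
          moreover have "(1 + b + x / (s / t * c)) * s + (1 + s / t * c + y / b) * t =
              (1 + b + c) * s + (1 + x / c + y / b) * t"
            using False nz by (simp add: field_simps)
          then have "\<theta> ((1 + b + x / (s / t * c)) * s) * \<theta> ((1 + s / t * c + y / b) * t) =
              \<theta> ((1 + b + c) * s) * \<theta> ((1 + x / c + y / b) * t)"
            by (simp only: add[symmetric])
          ultimately have "(?K (s / t * c) b * inverse B s * B t) *
              (\<theta> ((1 + b + x / (s / t * c)) * s) * \<theta> ((1 + s / t * c + y / b) * t)) =
              (?K c b * B s * inverse B t) * (\<theta> ((1 + b + c) * s) * \<theta> ((1 + x / c + y / b) * t))"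
            by simp
          then show ?thesis by (simp only: mult_ac)
        qed
      qed
      finally show ?thesis .
    qed (use zero_iff[of 0] in auto)
  qed
  also have "\<dots> = (\<Sum>c\<in>UNIV. \<Sum>b\<in>UNIV. \<Sum>s\<in>UNIV. \<Sum>t\<in>UNIV. ?K c b *
      (B s * \<theta> ((1 + b + c) * s)) * (inverse B t * \<theta> ((1 + x / c + y / b) * t)))"
    unfolding sum.cartesian_product
    by (intro sum.reindex_bij_witness[of _ "\<lambda>(a, b, s, t). (s, t, b, a)" "\<lambda>(s, t, b, a). (a, b, s, t)"])
      auto
  also have "\<dots> = (\<Sum>c\<in>UNIV. \<Sum>b\<in>UNIV. ?K c b *
      (inverse B (1 + b + c) * G B) * (B (1 + x / c + y / b) * G (inverse B)))"
    by (simp only: expand expand', simp only: mult.assoc sum_product, simp only: sum_distrib_left)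
  also have "\<dots> = ?R * (G (inverse B) * G B)"
    unfolding sum_distrib_right by (simp add: mult_ac)
  finally show ?thesis using G_nonzero[OF B(1)] G_nonzero[OF iB(1)] by simp
qed

end

text \<open>Replacing \<open>\<xi>\<close> by \<open>- m * \<xi>\<close> separates the variables
  into two Jacobi sums. The factor \<open>triv_char m\<close> discards \<open>m = 0\<close>, where
  \<open>\<xi> / 0 = 0\<close> would leave a spurious term.\<close>

lemma mellin_coefficient:
  fixes B \<chi> :: "'a::finite_field \<Rightarrow> complex"
  assumes B: "mult_char B" and \<chi>: "mult_char \<chi>"
  shows "(\<Sum>\<xi>\<in>UNIV. \<chi> \<xi> * (\<Sum>m\<in>UNIV. triv_char m * inverse B (1 + m) * B (1 + \<xi> / m))) =
    jacobi_sum \<chi> B * jacobi_sum \<chi> (inverse B)"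
proof -
  have *: "triv_char m * (\<Sum>\<xi>\<in>UNIV. \<chi> \<xi> * B (1 + \<xi> / m)) = \<chi> (- m) * jacobi_sum \<chi> B" for m
  proof (cases "m = 0")
    case False
    then have "(\<Sum>\<xi>\<in>UNIV. \<chi> \<xi> * B (1 + \<xi> / m)) = (\<Sum>\<xi>\<in>UNIV. \<chi> (- m * \<xi>) * B (1 + (- m * \<xi>) / m))"
      by (intro sum_UNIV_scale[symmetric]) simp
    also have "\<dots> = \<chi> (- m) * jacobi_sum \<chi> B"
      unfolding jacobi_sum_def sum_distrib_left mult_char_times[OF \<chi>] using False by (simp add: mult_ac)
    finally show ?thesis using False by (simp add: triv_char_def)
  qed (simp add: triv_char_def mult_char_0[OF \<chi>])
  have "(\<Sum>\<xi>\<in>UNIV. \<chi> \<xi> * (\<Sum>m\<in>UNIV. triv_char m * inverse B (1 + m) * B (1 + \<xi> / m))) =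
      (\<Sum>m\<in>UNIV. inverse B (1 + m) * (triv_char m * (\<Sum>\<xi>\<in>UNIV. \<chi> \<xi> * B (1 + \<xi> / m))))"
    unfolding sum_distrib_left by (subst sum.swap) (simp add: mult_ac)
  also have "\<dots> = jacobi_sum \<chi> B * (\<Sum>m\<in>UNIV. \<chi> (- m) * inverse B (1 + m))"
    unfolding * by (simp add: sum_distrib_left mult_ac)
  also have "(\<Sum>m\<in>UNIV. \<chi> (- m) * inverse B (1 + m)) = jacobi_sum \<chi> (inverse B)"
    unfolding jacobi_sum_def using sum_UNIV_minus[of "\<lambda>m. \<chi> m * inverse B (1 - m)"] by simp
  finally show ?thesis .
qed

text \<open>With \<open>b = c * k\<close> and \<open>m = c * (1 + k)\<close> the arguments become
  \<open>1 + m\<close> and \<open>1 + \<xi> / m\<close>, where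
  \<open>\<xi> = x * (1 + k) ^ 2 / k\<close>. Equality of the two shifts makes this possible, and
  the square in \<open>\<xi>\<close> produces \<open>\<chi> * \<chi>\<close>.\<close>

lemma double_sum_mellin:
  fixes B :: "'a::finite_field \<Rightarrow> complex"
  assumes B: "mult_char B" "B (- 1) = 1" and x: "x \<noteq> 0"
  shows "(of_nat CARD('a) - 1) * ((\<Sum>c\<in>UNIV. \<Sum>b\<in>UNIV. B ((c / b) ^ 2) * inverse B (1 + b + c) * B (1 + x / c + x / b))
      - (of_nat CARD('a) - 1)) =
    (\<Sum>\<chi> | mult_char \<chi>. \<chi> (- x) * (jacobi_sum (inverse \<chi>) B * jacobi_sum (inverse \<chi>) (inverse B))
      * jacobi_sum (inverse (B * B) * inverse \<chi>) (\<chi> * \<chi>))"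
proof -
  define N where "N = (\<lambda>\<xi>. \<Sum>m\<in>UNIV. triv_char m * inverse B (1 + m) * B (1 + \<xi> / m))"
  let ?Q = "of_nat CARD('a) - 1 :: complex"
  let ?J = "\<lambda>\<chi>. jacobi_sum (inverse \<chi>) B * jacobi_sum (inverse \<chi>) (inverse B)"
  define C where "C = (\<lambda>k. \<Sum>c\<in>UNIV. triv_char c * inverse B (1 + c * (1 + k)) * B (1 + x * (1 + k) / (k * c)))"
  have "(\<Sum>c\<in>UNIV. \<Sum>b\<in>UNIV. B ((c / b) ^ 2) * inverse B (1 + b + c) * B (1 + x / c + x / b)) =
      (\<Sum>c\<in>UNIV. \<Sum>k\<in>UNIV. B ((1 / k) ^ 2) * (triv_char c * inverse B (1 + c * (1 + k)) * B (1 + x * (1 + k) / (k * c))))"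
  proof (rule sum.cong[OF refl])
    fix c :: 'a
    let ?f = "\<lambda>b. B ((c / b) ^ 2) * inverse B (1 + b + c) * B (1 + x / c + x / b)"
    show "(\<Sum>b\<in>UNIV. ?f b) = (\<Sum>k\<in>UNIV. B ((1 / k) ^ 2) *
        (triv_char c * inverse B (1 + c * (1 + k)) * B (1 + x * (1 + k) / (k * c))))"
    proof (cases "c = 0")
      case False
      then have "(\<Sum>b\<in>UNIV. ?f b) = (\<Sum>k\<in>UNIV. ?f (c * k))"
        by (intro sum_UNIV_scale[symmetric])
      also have "\<dots> = (\<Sum>k\<in>UNIV. B ((1 / k) ^ 2) *
        (triv_char c * inverse B (1 + c * (1 + k)) * B (1 + x * (1 + k) / (k * c))))"
      proof (rule sum.cong[OF refl])
        fix k :: 'a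
        show "?f (c * k) = B ((1 / k) ^ 2) *
          (triv_char c * inverse B (1 + c * (1 + k)) * B (1 + x * (1 + k) / (k * c)))"
        proof (cases "k = 0")
          case nz: False
          have "c / (c * k) = 1 / k" "1 + c * k + c = 1 + c * (1 + k)"
            "1 + x / c + x / (c * k) = 1 + x * (1 + k) / (k * c)"
            using False nz by (simp_all add: field_simps)
          then show ?thesis using False by (simp only: triv_char_def if_False mult_1_left mult.assoc)
        qed (simp add: mult_char_0[OF B(1)])
      qed
      finally show ?thesis .
    qed (simp add: mult_char_0[OF B(1)] triv_char_def)
  qed
  also have "\<dots> = (\<Sum>k\<in>UNIV. B ((1 / k) ^ 2) * C k)"
    unfolding C_def sum_distrib_left by (rule sum.swap)
  also have "\<dots> = C (- 1) + (\<Sum>k\<in>UNIV - {- 1}. B ((1 / k) ^ 2) * C k)"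
    using mult_char_1[OF B(1)] by (subst sum.remove[of _ "- 1"]) auto
  \<comment> \<open>The fibre \<open>b = - c\<close>: here \<open>m\<close> is always
    \<open>0\<close>, both arguments of \<open>B\<close> are \<open>1\<close>, and each nonzero
    \<open>c\<close> contributes \<open>1\<close>. This is the \<open>q - 1\<close> subtracted in
    the statement.\<close>
  also have "C (- 1) = ?Q"
    by (simp add: C_def mult_char_1[OF B(1)] sum_mult_char mult_char_triv)
  also have "(\<Sum>k\<in>UNIV - {- 1}. B ((1 / k) ^ 2) * C k) = (\<Sum>k\<in>UNIV - {0, - 1}. B ((1 / k) ^ 2) * N (x * (1 + k) ^ 2 / k))"
  proof (intro sum.mono_neutral_cong_right)
    fix k :: 'a assume "k \<in> UNIV - {0, - 1}"
    then have k: "k \<noteq> 0" "1 + k \<noteq> 0" by (auto simp: add_eq_0_iff)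
    let ?f = "\<lambda>m. triv_char m * inverse B (1 + m) * B (1 + x * (1 + k) ^ 2 / k / m)"
    have "N (x * (1 + k) ^ 2 / k) = (\<Sum>c\<in>UNIV. ?f ((1 + k) * c))"
      unfolding N_def using k(2) by (intro sum_UNIV_scale[symmetric])
    also have "\<dots> = C k"
      unfolding C_def
    proof (rule sum.cong[OF refl])
      fix c :: 'a
      have "x * (1 + k) ^ 2 / k / ((1 + k) * c) = x * (1 + k) / (k * c)"
        using k by (simp add: power2_eq_square)
      then show "?f ((1 + k) * c) = triv_char c * inverse B (1 + c * (1 + k)) * B (1 + x * (1 + k) / (k * c))"
        using k by (simp add: triv_char_def mult.commute[of c])
    qed
    finally show "B ((1 / k) ^ 2) * C k = B ((1 / k) ^ 2) * N (x * (1 + k) ^ 2 / k)" by simp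
  qed (auto simp: mult_char_0[OF B(1)])
  finally have "?Q * ((\<Sum>c\<in>UNIV. \<Sum>b\<in>UNIV. B ((c / b) ^ 2) * inverse B (1 + b + c) * B (1 + x / c + x / b)) - ?Q) =
      (\<Sum>k\<in>UNIV - {0, - 1}. B ((1 / k) ^ 2) * (?Q * N (x * (1 + k) ^ 2 / k)))"
    by (simp add: sum_distrib_left mult_ac)
  also have "\<dots> = (\<Sum>k\<in>UNIV - {0, - 1}. \<Sum>\<chi> | mult_char \<chi>. B ((1 / k) ^ 2) * (\<chi> (x * (1 + k) ^ 2 / k) * ?J \<chi>))"
  proof (rule sum.cong[OF refl])
    fix k :: 'a assume "k \<in> UNIV - {0, - 1}"
    then have "x * (1 + k) ^ 2 / k \<noteq> 0" using x by (auto simp: add_eq_0_iff)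
    then have "?Q * N (x * (1 + k) ^ 2 / k) = (\<Sum>\<chi> | mult_char \<chi>. \<chi> (x * (1 + k) ^ 2 / k) *
        (\<Sum>y\<in>UNIV. inverse \<chi> y * N y))"
      by (rule mellin_inversion)
    also have "\<dots> = (\<Sum>\<chi> | mult_char \<chi>. \<chi> (x * (1 + k) ^ 2 / k) * ?J \<chi>)"
      using mellin_coefficient[OF B(1) mult_char_inverse] by (intro sum.cong refl) (simp add: N_def)
    finally show "B ((1 / k) ^ 2) * (?Q * N (x * (1 + k) ^ 2 / k)) =
        (\<Sum>\<chi> | mult_char \<chi>. B ((1 / k) ^ 2) * (\<chi> (x * (1 + k) ^ 2 / k) * ?J \<chi>))"
      by (simp add: sum_distrib_left)
  qed
  also have "\<dots> = (\<Sum>\<chi> | mult_char \<chi>. ?J \<chi> * (\<Sum>k\<in>UNIV - {0, - 1}. B ((1 / k) ^ 2) * \<chi> (x * (1 + k) ^ 2 / k)))"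
    unfolding sum_distrib_left by (subst sum.swap) (simp add: mult_ac)
  also have "\<dots> = (\<Sum>\<chi> | mult_char \<chi>. \<chi> (- x) * ?J \<chi> * jacobi_sum (inverse (B * B) * inverse \<chi>) (\<chi> * \<chi>))"
  proof (rule sum.cong[OF refl])
    fix \<chi> :: "'a \<Rightarrow> complex" assume "\<chi> \<in> {\<chi>. mult_char \<chi>}"
    then have \<chi>: "mult_char \<chi>" by simp
    have *: "B ((1 / k) ^ 2) * \<chi> (x * (1 + k) ^ 2 / k) = \<chi> x * ((inverse (B * B) * inverse \<chi>) k * (\<chi> * \<chi>) (1 + k))" for k
      by (simp add: mult_char_divide[OF B(1)] mult_char_divide[OF \<chi>] mult_char_times[OF \<chi>]
          mult_char_power[OF B(1)] mult_char_power[OF \<chi>] mult_char_1[OF B(1)]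
          mult_char_times[OF B(1)] mult_char_inverse_arg[OF B(1)] mult_char_inverse_arg[OF \<chi>]
          power2_eq_square divide_inverse mult_ac)
    \<comment> \<open>The points \<open>k = 0\<close> and \<open>k = - 1\<close> can be restored,
      since characters, even trivial ones, vanish at \<open>0\<close>.\<close>
    have "(\<Sum>k\<in>UNIV - {0, - 1}. B ((1 / k) ^ 2) * \<chi> (x * (1 + k) ^ 2 / k)) =
        (\<Sum>k\<in>UNIV. \<chi> x * ((inverse (B * B) * inverse \<chi>) k * (\<chi> * \<chi>) (1 + k)))"
      unfolding * by (intro sum.mono_neutral_left) (auto simp: mult_char_0[OF B(1)] mult_char_0[OF \<chi>])
    also have "\<dots> = \<chi> x * (\<Sum>k\<in>UNIV. (inverse (B * B) * inverse \<chi>) (- k) * (\<chi> * \<chi>) (1 - k))"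
      using sum_UNIV_minus[of "\<lambda>k. (inverse (B * B) * inverse \<chi>) k * (\<chi> * \<chi>) (1 + k)"]
      by (simp add: sum_distrib_left)
    also have "\<dots> = \<chi> (- x) * jacobi_sum (inverse (B * B) * inverse \<chi>) (\<chi> * \<chi>)"
    proof -
      have "(inverse (B * B) * inverse \<chi>) (- k) = \<chi> (- 1) * (inverse (B * B) * inverse \<chi>) k" for k
      proof -
        have "inverse (\<chi> (- 1)) = \<chi> (- 1)" using mult_char_minus_1_square[OF \<chi>] by (simp add: inverse_unique)
        then show ?thesis
          by (simp add: mult_char_minus[OF \<chi>, of k] mult_char_minus[OF B(1), of k] B(2) mult_ac)
      qed
      then show ?thesis
        unfolding jacobi_sum_def mult_char_minus[OF \<chi>, of x] by (simp add: sum_distrib_left mult_ac)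
    qed
    finally show "?J \<chi> * (\<Sum>k\<in>UNIV - {0, - 1}. B ((1 / k) ^ 2) * \<chi> (x * (1 + k) ^ 2 / k)) =
        \<chi> (- x) * ?J \<chi> * jacobi_sum (inverse (B * B) * inverse \<chi>) (\<chi> * \<chi>)"
      by (simp only: mult_ac)
  qed
  finally show ?thesis .
qed

section \<open>Evaluation of the series\<close>

lemma char_eqI:
  assumes "mult_char \<chi>" "mult_char \<psi>" "\<And>x. x \<noteq> 0 \<Longrightarrow> \<chi> x = \<psi> x"
  shows "\<chi> = \<psi>"
proof
  fix x
  show "\<chi> x = \<psi> x"
    using assms mult_char_0[OF assms(1)] mult_char_0[OF assms(2)] by (cases "x = 0") auto
qed

text \<open>Adding the twist by \<open>quad_char\<close> creates the weight
  \<open>1 + quad_char t\<close>, which replaces \<open>t\<close> by \<open>y ^ 2\<close>; since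
  \<open>A (y ^ 2) = (A * A) y\<close>, the factors merge into a value of \<open>A * A\<close> at
  the cubic.\<close>

lemma char_binom_pair:
  fixes A :: "'a::finite_field \<Rightarrow> complex"
  assumes A: "mult_char A" and two: "(2::'a) \<noteq> 0"
  shows "char_binom A (inverse (A * A)) + char_binom (quad_char * A) (inverse (A * A)) =
    (\<Sum>y\<in>UNIV. (A * A) (y ^ 3 - y)) / of_nat CARD('a)"
proof -
  have "inverse (A * A) (- 1) = 1" using mult_char_minus_1_square[OF A] by simp
  then have "char_binom A (inverse (A * A)) + char_binom (quad_char * A) (inverse (A * A)) =
      (jacobi_sum A (A * A) + jacobi_sum (quad_char * A) (A * A)) / of_nat CARD('a)"
    by (simp only: char_binom_jacobi inverse_char_inverse) (simp add: add_divide_distrib)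
  also have "jacobi_sum A (A * A) + jacobi_sum (quad_char * A) (A * A) =
      (\<Sum>t\<in>UNIV. (1 + quad_char t) * (A t * (A * A) (1 - t)))"
    by (simp add: jacobi_sum_def sum.distrib algebra_simps)
  also have "\<dots> = (\<Sum>y\<in>UNIV. A (y ^ 2) * (A * A) (1 - y ^ 2))"
    using two by (rule sum_square_arg[symmetric])
  also have "\<dots> = (\<Sum>y\<in>UNIV. (A * A) (y ^ 3 - y))"
  proof (rule sum.cong[OF refl])
    fix y :: 'a
    have "y ^ 3 - y = - (y * (1 - y ^ 2))"
      by (simp add: power2_eq_square power3_eq_cube algebra_simps)
    then have "A (y ^ 3 - y) = A (- 1) * (A y * A (1 - y ^ 2))"
      by (simp only: mult_char_minus[OF A, of "y * (1 - y ^ 2)"] mult_char_times[OF A])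
    then have "(A * A) (y ^ 3 - y) = (A (- 1) * A (- 1)) * ((A y * A y) * (A * A) (1 - y ^ 2))"
      by (simp add: mult_ac)
    then show "A (y ^ 2) * (A * A) (1 - y ^ 2) = (A * A) (y ^ 3 - y)"
      by (simp add: mult_char_minus_1_square[OF A] mult_char_times[OF A] power2_eq_square mult_ac)
  qed
  finally show ?thesis .
qed

text \<open>The three binomial prefactors contribute \<open>\<chi> (- 1) ^ 3\<close>, as
  \<open>B (- 1) = 1\<close>. Together with the sign of \<open>- 8\<close> this is \<open>1\<close>,
  which leaves \<open>\<chi> 8\<close>.\<close>

lemma greene_F_jacobi:
  fixes B :: "'a::finite_field \<Rightarrow> complex"
  assumes B: "mult_char B" "B (- 1) = 1"
  shows "of_nat CARD('a) ^ 2 * (of_nat CARD('a) - 1) *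
      greene_F (inverse B) [B, quad_char] [B * B, inverse (B * B)] (- 8) =
    (\<Sum>\<chi> | mult_char \<chi>. \<chi> 8 * (jacobi_sum (inverse B * \<chi>) (inverse \<chi>) *
      jacobi_sum (B * \<chi>) (inverse (B * B * \<chi>)) * jacobi_sum (quad_char * \<chi>) (inverse (inverse (B * B) * \<chi>))))"
    (is "_ = (\<Sum>\<chi> | mult_char \<chi>. \<chi> 8 * ?j \<chi>)")
proof -
  let ?q = "of_nat CARD('a) :: complex"
  have q: "?q \<noteq> 0" "?q - 1 \<noteq> 0"
  proof -
    have "card {0, 1 :: 'a} \<le> CARD('a)" by (rule card_mono) auto
    then have "CARD('a) \<noteq> 0" "CARD('a) \<noteq> 1" by auto
    then show "?q \<noteq> 0" "?q - 1 \<noteq> 0" by (simp_all del: One_nat_def)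
  qed
  have summand: "char_binom (inverse B * \<chi>) \<chi> * (\<Prod>i<length [B * B, inverse (B * B)].
      char_binom ([B, quad_char] ! i * \<chi>) ([B * B, inverse (B * B)] ! i * \<chi>)) * \<chi> (- 8) =
      \<chi> 8 * ?j \<chi> / ?q ^ 3" if \<chi>: "mult_char \<chi>" for \<chi>
  proof -
    have 1: "\<chi> (- 1) * (\<chi> (- 1) * y) = y" for y
      using mult_char_minus_1_square[OF \<chi>] by (simp flip: mult.assoc)
    show ?thesis
      by (simp add: lessThan_Suc char_binom_jacobi B(2) mult_char_minus[OF \<chi>, of 8] power3_eq_cube 1 mult_ac)
  qed
  have "greene_F (inverse B) [B, quad_char] [B * B, inverse (B * B)] (- 8) =
      ?q / (?q - 1) * (\<Sum>\<chi> | mult_char \<chi>. \<chi> 8 * ?j \<chi> / ?q ^ 3)"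
    unfolding greene_F_def by (rule arg_cong[of _ _ "\<lambda>s. ?q / (?q - 1) * s"], rule sum.cong[OF refl], rule summand) simp
  also have "\<dots> = ?q / (?q - 1) * ((\<Sum>\<chi> | mult_char \<chi>. \<chi> 8 * ?j \<chi>) / ?q ^ 3)"
    by (simp only: sum_divide_distrib)
  finally have F: "greene_F (inverse B) [B, quad_char] [B * B, inverse (B * B)] (- 8) =
      ?q / (?q - 1) * ((\<Sum>\<chi> | mult_char \<chi>. \<chi> 8 * ?j \<chi>) / ?q ^ 3)" .
  show ?thesis
  proof -
    have "x ^ 2 * (x - 1) * (x / (x - 1) * (s / x ^ 3)) = s" if "x \<noteq> 0" "x - 1 \<noteq> 0" for x s :: complex
    proof -
      have "x ^ 2 * (x - 1) * (x / (x - 1) * (s / x ^ 3)) = ((x - 1) / (x - 1)) * (x ^ 3 / x ^ 3) * s"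
        by (simp add: power2_eq_square power3_eq_cube)
      then show ?thesis using that by simp
    qed
    then show ?thesis
      unfolding F using q by blast
  qed
qed

section \<open>Gauss sum comparison of the Mellin expansion with Greene's series\<close>

context additive_character
begin

text \<open>These two Jacobi sums are what the prefactors of the theorem amount to. The lemma
  matches them with the denominators in \<open>series_term_eval\<close>; the factor \<open>q\<close>
  is absorbed as \<open>G B * G (inverse B)\<close>.\<close>

lemma jacobi_sums_eval:
  fixes B :: "'a \<Rightarrow> complex"
  assumes two: "(2::'a) \<noteq> 0" and B: "mult_char B" "B (- 1) = 1" "B \<noteq> triv_char"
  shows "jacobi_sum (inverse (B * B)) (B * B * quad_char) * jacobi_sum (inverse B) (B * B) *
      of_nat CARD('a) * G quad_char =
    (if B * B = triv_char then 1 else of_nat CARD('a)) *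
      (G (inverse B) * G (inverse B) * G (quad_char * (B * B)))"
proof -
  let ?\<phi> = "quad_char :: 'a \<Rightarrow> complex"
  note mc = mult_char_mult mult_char_inverse mult_char_quad B(1)
  have "inverse (B * B) * (B * B * ?\<phi>) = ?\<phi>" "inverse B * (B * B) = B"
    using mult_inverse_char_cancel'(2)[of "B * B" ?\<phi>] mult_inverse_char_cancel'(2)[of B B] by (simp_all add: mc)
  then have J: "jacobi_sum (inverse (B * B)) (B * B * ?\<phi>) * G ?\<phi> = G (inverse (B * B)) * G (B * B * ?\<phi>)"
      "jacobi_sum (inverse B) (B * B) * G B = G (inverse B) * G (B * B)"
    using G_mult[of "inverse (B * B)" "B * B * ?\<phi>"] G_mult[of "inverse B" "B * B"] B quad_char_neq_triv[OF two]
    by (simp_all add: mc)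
  have q: "G B * G (inverse B) = of_nat CARD('a)"
    using G_inverse[OF B(1,3)] B(2) by simp
  have Q: "G (B * B) * G (inverse (B * B)) = (if B * B = triv_char then 1 else of_nat CARD('a))"
    using G_inverse'[of "B * B"] B(2) by (simp add: mc)
  have "jacobi_sum (inverse (B * B)) (B * B * ?\<phi>) * jacobi_sum (inverse B) (B * B) * of_nat CARD('a) * G ?\<phi> =
      (jacobi_sum (inverse (B * B)) (B * B * ?\<phi>) * G ?\<phi>) * (jacobi_sum (inverse B) (B * B) * G B) * G (inverse B)"
    unfolding q[symmetric] by (simp only: mult_ac)
  also have "\<dots> = (G (B * B) * G (inverse (B * B))) * (G (inverse B) * G (inverse B) * G (?\<phi> * (B * B)))"
    unfolding J by (simp only: mult_ac)
  finally show ?thesis unfolding Q .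
qed

lemma jacobi_sum_nonzero:
  fixes \<chi> \<psi> :: "'a \<Rightarrow> complex"
  assumes "mult_char \<chi>" "mult_char \<psi>" "\<chi> * \<psi> \<noteq> triv_char"
  shows "jacobi_sum \<chi> \<psi> \<noteq> 0"
  using G_mult[OF assms] G_nonzero[OF assms(1)] G_nonzero[OF assms(2)] by auto

text \<open>In each Jacobi sum \<open>\<chi>\<close> cancels from the product of the two characters,
  which leaves \<open>inverse B\<close> twice and \<open>quad_char * (B * B)\<close>. All are
  nontrivial, so \<open>G_mult\<close> applies uniformly in \<open>\<chi>\<close>.\<close>

lemma series_term_eval:
  fixes B \<chi> :: "'a \<Rightarrow> complex"
  assumes B: "mult_char B" "B \<noteq> triv_char" "B * B \<noteq> quad_char" and \<chi>: "mult_char \<chi>"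
  shows "jacobi_sum (inverse B * \<chi>) (inverse \<chi>) * jacobi_sum (B * \<chi>) (inverse (B * B * \<chi>)) *
      jacobi_sum (quad_char * \<chi>) (inverse (inverse (B * B) * \<chi>)) *
      (G (inverse B) * G (inverse B) * G (quad_char * (B * B))) =
    G (inverse \<chi>) * G (inverse B * \<chi>) * G (B * \<chi>) * G (inverse (B * B * \<chi>)) *
      G (inverse (inverse (B * B) * \<chi>)) * G (quad_char * \<chi>)"
proof -
  let ?\<phi> = "quad_char :: 'a \<Rightarrow> complex"
  note mc = mult_char_mult mult_char_inverse mult_char_quad B(1) \<chi>
  note nz = mult_char_eq_0_iff[OF B(1)] mult_char_eq_0_iff[OF \<chi>]
  have prods: "inverse B * \<chi> * inverse \<chi> = inverse B" "B * \<chi> * inverse (B * B * \<chi>) = inverse B"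
      "?\<phi> * \<chi> * inverse (inverse (B * B) * \<chi>) = ?\<phi> * (B * B)"
    by (rule char_eqI; simp add: mc nz field_simps)+
  have "?\<phi> * (B * B) \<noteq> triv_char"
    using B(3) by (metis char_eq_inverse_iff inverse_quad_char mult_char_mult mult_char_quad B(1))
  moreover have "inverse B \<noteq> triv_char" using B by (simp add: inverse_char_eq_triv_iff)
  ultimately have
    "jacobi_sum (inverse B * \<chi>) (inverse \<chi>) * G (inverse B) = G (inverse B * \<chi>) * G (inverse \<chi>)"
    "jacobi_sum (B * \<chi>) (inverse (B * B * \<chi>)) * G (inverse B) = G (B * \<chi>) * G (inverse (B * B * \<chi>))"
    "jacobi_sum (?\<phi> * \<chi>) (inverse (inverse (B * B) * \<chi>)) * G (?\<phi> * (B * B)) =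
      G (?\<phi> * \<chi>) * G (inverse (inverse (B * B) * \<chi>))"
    using G_mult[of "inverse B * \<chi>" "inverse \<chi>"] G_mult[of "B * \<chi>" "inverse (B * B * \<chi>)"]
      G_mult[of "?\<phi> * \<chi>" "inverse (inverse (B * B) * \<chi>)"]
    unfolding prods by (simp_all add: mc)
  then have "(jacobi_sum (inverse B * \<chi>) (inverse \<chi>) * G (inverse B)) *
      (jacobi_sum (B * \<chi>) (inverse (B * B * \<chi>)) * G (inverse B)) *
      (jacobi_sum (?\<phi> * \<chi>) (inverse (inverse (B * B) * \<chi>)) * G (?\<phi> * (B * B))) =
      (G (inverse B * \<chi>) * G (inverse \<chi>)) * (G (B * \<chi>) * G (inverse (B * B * \<chi>))) *
      (G (?\<phi> * \<chi>) * G (inverse (inverse (B * B) * \<chi>)))"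
    by simp
  then show ?thesis by (simp only: mult_ac)
qed

text \<open>The products of characters now depend on \<open>\<chi>\<close>, so
  \<open>jacobi_sum_eq_G\<close> replaces \<open>G_mult\<close>. The case excluded by the last
  assumption is that of a Jacobi sum of two trivial characters.\<close>

lemma mellin_term_eval:
  fixes B \<chi> :: "'a \<Rightarrow> complex"
  assumes two: "(2::'a) \<noteq> 0" and B: "mult_char B" "B (- 1) = 1" "B \<noteq> triv_char" "B * B \<noteq> quad_char"
    and \<chi>: "mult_char \<chi>" "B * B \<noteq> triv_char \<or> \<chi> \<noteq> triv_char"
  shows "\<chi> 2 * (jacobi_sum (inverse \<chi>) B * jacobi_sum (inverse \<chi>) (inverse B)) *
      jacobi_sum (inverse (B * B) * inverse \<chi>) (\<chi> * \<chi>) * (of_nat CARD('a) ^ 2 * G quad_char) =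
    \<chi> 8 * (G (inverse \<chi>) * G (inverse B * \<chi>) * G (B * \<chi>) * G (inverse (B * B * \<chi>)) *
      G (inverse (inverse (B * B) * \<chi>)) * G (quad_char * \<chi>)) * (if \<chi> = triv_char then 1 else of_nat CARD('a))"
proof -
  let ?\<phi> = "quad_char :: 'a \<Rightarrow> complex" and ?q = "of_nat CARD('a) :: complex"
  note mc = mult_char_mult mult_char_inverse mult_char_quad B(1) \<chi>(1)
  note nz = mult_char_eq_0_iff[OF B(1)] mult_char_eq_0_iff[OF \<chi>(1)]
  have sign: "inverse (\<chi> (- 1)) = \<chi> (- 1)" "\<chi> (- 1) * \<chi> (- 1) = 1"
    using mult_char_minus_1_square[OF \<chi>(1)] by (simp_all add: inverse_unique)
  have q0: "?q \<noteq> 0" by simp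
  have invs: "inverse (inverse \<chi> * B) = inverse B * \<chi>" "inverse (inverse \<chi> * inverse B) = B * \<chi>"
    "inverse (inverse (B * B) * inverse \<chi> * (\<chi> * \<chi>)) = inverse (inverse (B * B) * \<chi>)"
    "inverse (B * B) * inverse \<chi> = inverse (B * B * \<chi>)"
    by (rule char_eqI; simp add: mc nz)+
  have J1: "jacobi_sum (inverse \<chi>) B * ?q = \<chi> (- 1) * G (inverse \<chi>) * G B * G (inverse B * \<chi>)"
    using jacobi_sum_eq_G[of "inverse \<chi>" B] B unfolding invs by (simp add: mc sign)
  have J2: "jacobi_sum (inverse \<chi>) (inverse B) * ?q = \<chi> (- 1) * G (inverse \<chi>) * G (inverse B) * G (B * \<chi>)"
    using jacobi_sum_eq_G[of "inverse \<chi>" "inverse B"] B unfolding invs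
    by (simp add: mc sign inverse_char_eq_triv_iff)
  \<comment> \<open>If both were trivial, \<open>\<chi>\<close> would be trivial or quadratic and
    equal to the inverse of \<open>B * B\<close>; both cases are excluded.\<close>
  have "inverse (B * B) * inverse \<chi> \<noteq> triv_char \<or> \<chi> * \<chi> \<noteq> triv_char"
  proof (rule ccontr)
    assume "\<not> ?thesis"
    then have 1: "inverse (B * B) * inverse \<chi> = triv_char" and 2: "\<chi> * \<chi> = triv_char" by auto
    have "\<chi> = triv_char \<or> \<chi> = ?\<phi>" using char_square_eq_triv[OF \<chi>(1) 2] by blast
    moreover have "inverse \<chi> = B * B"
      using 1 by (simp add: char_eq_inverse_iff mc)
    ultimately have "\<chi> = triv_char \<and> B * B = triv_char \<or> B * B = ?\<phi>"
      by (auto simp: inverse_quad_char)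
    then show False using B(4) \<chi>(2) by blast
  qed
  then have J3: "jacobi_sum (inverse (B * B) * inverse \<chi>) (\<chi> * \<chi>) * ?q =
      \<chi> (- 1) * G (inverse (B * B * \<chi>)) * G (\<chi> * \<chi>) * G (inverse (inverse (B * B) * \<chi>))"
    using jacobi_sum_eq_G[of "inverse (B * B) * inverse \<chi>" "\<chi> * \<chi>"] unfolding invs(3) unfolding invs(4)
    by (simp add: mc sign B(2))
  have q: "G B * G (inverse B) = ?q"
    using G_inverse[OF B(1,3)] B(2) by simp
  have hd: "G ?\<phi> * G (\<chi> * \<chi>) = \<chi> 4 * G \<chi> * G (?\<phi> * \<chi>)"
    using hasse_davenport_quadratic[OF two \<chi>(1)] by (simp add: mult.commute[of \<chi> ?\<phi>])
  have G\<chi>: "\<chi> (- 1) * (G \<chi> * G (inverse \<chi>)) = (if \<chi> = triv_char then 1 else ?q)"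
    by (rule G_inverse'[OF \<chi>(1)])
  have \<chi>8: "\<chi> 8 = \<chi> 2 * \<chi> 4" by (simp flip: mult_char_times[OF \<chi>(1)])
  have "(\<chi> 2 * (jacobi_sum (inverse \<chi>) B * jacobi_sum (inverse \<chi>) (inverse B)) *
      jacobi_sum (inverse (B * B) * inverse \<chi>) (\<chi> * \<chi>) * (?q ^ 2 * G ?\<phi>)) * ?q =
      \<chi> 2 * (jacobi_sum (inverse \<chi>) B * ?q) * (jacobi_sum (inverse \<chi>) (inverse B) * ?q) *
      (jacobi_sum (inverse (B * B) * inverse \<chi>) (\<chi> * \<chi>) * ?q) * G ?\<phi>"
    by (simp add: power2_eq_square mult_ac)
  also have "\<dots> = \<chi> 2 * (\<chi> (- 1) * \<chi> (- 1)) * (\<chi> (- 1) * (G (inverse \<chi>) * G (inverse \<chi>))) * (G B * G (inverse B)) *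
      G (inverse B * \<chi>) * G (B * \<chi>) * G (inverse (B * B * \<chi>)) * G (inverse (inverse (B * B) * \<chi>)) *
      (G ?\<phi> * G (\<chi> * \<chi>))"
    unfolding J1 J2 J3 by (simp only: mult_ac)
  \<comment> \<open>The factor \<open>G \<chi>\<close> from Hasse-Davenport pairs with one of the
    two copies of \<open>G (inverse \<chi>)\<close>; their product is irregular only at the trivial
    character.\<close>
  also have "\<dots> = (\<chi> 2 * \<chi> 4) * (\<chi> (- 1) * (G \<chi> * G (inverse \<chi>))) * G (inverse \<chi>) *
      G (inverse B * \<chi>) * G (B * \<chi>) * G (inverse (B * B * \<chi>)) * G (inverse (inverse (B * B) * \<chi>)) *
      G (?\<phi> * \<chi>) * ?q"
    unfolding hd q sign(2) by (simp only: mult_1_right mult_1_left mult_ac)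
  also have "\<dots> = (\<chi> 8 * (G (inverse \<chi>) * G (inverse B * \<chi>) * G (B * \<chi>) * G (inverse (B * B * \<chi>)) *
      G (inverse (inverse (B * B) * \<chi>)) * G (?\<phi> * \<chi>)) * (if \<chi> = triv_char then 1 else ?q)) * ?q"
    unfolding \<chi>8 G\<chi> by (simp only: mult_ac)
  finally show ?thesis by (rule mult_right_cancel[OF q0, THEN iffD1])
qed

text \<open>Both expansions agree up to a constant factor except at the trivial character. The
  \<open>1\<close> arising there and the \<open>q - 1\<close> of \<open>double_sum_mellin\<close>
  add up to the \<open>q\<close> on the right.\<close>

lemma greene_F_eq_double_sum:
  fixes B :: "'a \<Rightarrow> complex"
  assumes two: "(2::'a) \<noteq> 0" and B: "mult_char B" "B (- 1) = 1" "B \<noteq> triv_char" "B * B \<noteq> quad_char"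
  defines "q \<equiv> of_nat CARD('a) :: complex"
    and "P \<equiv> (\<Sum>c\<in>UNIV. \<Sum>b\<in>UNIV. B ((c / b) ^ 2) * inverse B (1 + b + c) * B (1 + - 2 / c + - 2 / b))"
    and "F \<equiv> greene_F (inverse B) [B, quad_char] [B * B, inverse (B * B)] (- 8)"
    and "J0 \<equiv> jacobi_sum (inverse (B * B)) (B * B * quad_char)"
    and "J1 \<equiv> jacobi_sum (inverse B) (B * B)"
  shows "B * B \<noteq> triv_char \<Longrightarrow> J0 * J1 * q * F = P - q"
    and "B * B = triv_char \<Longrightarrow> q ^ 2 * F = P - q"
proof -
  let ?\<phi> = "quad_char :: 'a \<Rightarrow> complex" and ?T = "triv_char :: 'a \<Rightarrow> complex"
  let ?C = "{\<chi> :: 'a \<Rightarrow> complex. mult_char \<chi>}"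
  define j where "j = (\<lambda>\<chi>. jacobi_sum (inverse B * \<chi>) (inverse \<chi>) *
      jacobi_sum (B * \<chi>) (inverse (B * B * \<chi>)) * jacobi_sum (?\<phi> * \<chi>) (inverse (inverse (B * B) * \<chi>)))"
  define com where "com = (\<lambda>\<chi>. G (inverse \<chi>) * G (inverse B * \<chi>) * G (B * \<chi>) * G (inverse (B * B * \<chi>)) *
      G (inverse (inverse (B * B) * \<chi>)) * G (?\<phi> * \<chi>))"
  define R where "R = (\<lambda>\<chi>. \<chi> 2 * (jacobi_sum (inverse \<chi>) B * jacobi_sum (inverse \<chi>) (inverse B)) *
      jacobi_sum (inverse (B * B) * inverse \<chi>) (\<chi> * \<chi>))"
  define Q where "Q = (if B * B = ?T then 1 else q)"
  note mc = mult_char_mult mult_char_inverse mult_char_quad mult_char_triv B(1)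
  have "card {0, 1 :: 'a} \<le> CARD('a)" by (rule card_mono) auto
  then have "CARD('a) \<noteq> 0" "CARD('a) \<noteq> 1" by auto
  then have q: "q \<noteq> 0" "q - 1 \<noteq> 0" unfolding q_def by (simp_all del: One_nat_def)
  have G\<phi>: "G ?\<phi> \<noteq> 0" by (simp add: G_nonzero mult_char_quad)
  have eight: "(8::'a) \<noteq> 0"
  proof -
    have "(8::'a) = 2 ^ 3" by simp
    then show ?thesis using two by (metis power_not_zero)
  qed
  have F: "q ^ 2 * (q - 1) * F = (\<Sum>\<chi>\<in>?C. \<chi> 8 * j \<chi>)"
    unfolding q_def F_def j_def by (rule greene_F_jacobi[OF B(1,2)])
  have P: "(q - 1) * (P - (q - 1)) = (\<Sum>\<chi>\<in>?C. R \<chi>)"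
    using double_sum_mellin[OF B(1,2), of "- 2"] two unfolding q_def P_def R_def by simp
  have Q: "J0 * J1 * q * G ?\<phi> = Q * (G (inverse B) * G (inverse B) * G (?\<phi> * (B * B)))"
    unfolding J0_def J1_def q_def Q_def by (rule jacobi_sums_eval[OF two B(1-3)])
  have j: "J0 * J1 * q * G ?\<phi> * j \<chi> = Q * com \<chi>" if "mult_char \<chi>" for \<chi>
  proof -
    have "j \<chi> * (G (inverse B) * G (inverse B) * G (?\<phi> * (B * B))) = com \<chi>"
      unfolding j_def com_def using B that by (intro series_term_eval)
    then show ?thesis unfolding Q by (metis mult.assoc mult.commute)
  qed
  have R: "R \<chi> * (q ^ 2 * G ?\<phi>) = \<chi> 8 * com \<chi> * (if \<chi> = ?T then 1 else q)"
    if "mult_char \<chi>" "B * B \<noteq> ?T \<or> \<chi> \<noteq> ?T" for \<chi>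
    unfolding R_def com_def q_def using two B that by (intro mellin_term_eval)
  have GB: "G B * G (inverse B) = q"
    using G_inverse[OF B(1,3)] B(2) by (simp add: q_def)
  have GBB: "G (B * B) * G (inverse (B * B)) = Q"
    using G_inverse'[of "B * B"] B(2) by (simp add: mc Q_def q_def)
  \<comment> \<open>At the trivial character the six Gauss sums are
    \<open>G triv_char = - 1\<close>, two inverse pairs and \<open>G ?\<phi>\<close>.\<close>
  have com_triv: "com ?T = - q * Q * G ?\<phi>"
  proof -
    have "com ?T = G ?T * (G B * G (inverse B)) * (G (B * B) * G (inverse (B * B))) * G ?\<phi>"
      unfolding com_def by (simp add: mult_triv_char mc)
    then show ?thesis unfolding GB GBB by (simp add: G_triv)
  qed
  have T8: "?T 8 = 1" using eight by (simp add: triv_char_def)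
  have fin: "finite ?C" by (rule finite_mult_chars)
  have T: "?T \<in> ?C" by (simp add: mult_char_triv)
  {
    assume BB: "B * B \<noteq> triv_char"
    then have "Q = q" by (simp add: Q_def)
    \<comment> \<open>The correction is \<open>(1 - q) * com ?T\<close> divided by
      \<open>q * G ?\<phi>\<close>, with \<open>com ?T = - q * q * G ?\<phi>\<close>.\<close>
    have R': "R \<chi> * q = J0 * J1 * (\<chi> 8 * j \<chi>) + (if \<chi> = ?T then (q - 1) * q else 0)" if "\<chi> \<in> ?C" for \<chi>
    proof -
      from that have \<chi>: "mult_char \<chi>" by simp
      have jc: "J0 * J1 * G ?\<phi> * j \<chi> = com \<chi>"
        using j[OF \<chi>] q by (simp add: \<open>Q = q\<close> mult_ac)
      have "(R \<chi> * q) * (q * G ?\<phi>) = \<chi> 8 * com \<chi> * (if \<chi> = ?T then 1 else q)"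
        using R[OF \<chi>] BB by (simp add: power2_eq_square mult_ac)
      also have "\<dots> = \<chi> 8 * com \<chi> * q - (if \<chi> = ?T then (q - 1) * com ?T else 0)"
        by (simp add: T8 algebra_simps)
      also have "\<dots> = \<chi> 8 * com \<chi> * q + (if \<chi> = ?T then (q - 1) * q else 0) * (q * G ?\<phi>)"
        unfolding com_triv \<open>Q = q\<close> by simp
      also have "\<dots> = (J0 * J1 * (\<chi> 8 * j \<chi>) + (if \<chi> = ?T then (q - 1) * q else 0)) * (q * G ?\<phi>)"
        unfolding jc[symmetric] by (cases "\<chi> = ?T") (simp_all add: algebra_simps)
      finally show ?thesis using q G\<phi> by (metis mult_cancel_right mult_eq_0_iff)
    qed
    have "(q - 1) * (P - (q - 1)) * q = (\<Sum>\<chi>\<in>?C. R \<chi> * q)"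
      unfolding P sum_distrib_right ..
    also have "\<dots> = (\<Sum>\<chi>\<in>?C. J0 * J1 * (\<chi> 8 * j \<chi>) + (if \<chi> = ?T then (q - 1) * q else 0))"
      by (rule sum.cong[OF refl R'])
    also have "\<dots> = J0 * J1 * (q ^ 2 * (q - 1) * F) + (q - 1) * q"
      unfolding F sum.distrib sum_distrib_left using T fin by simp
    finally have "(q - 1) * q * (P - (q - 1)) = (q - 1) * q * (J0 * J1 * q * F + 1)"
      by (simp add: algebra_simps power2_eq_square)
    moreover have "(q - 1) * q \<noteq> 0" using q by (metis mult_eq_0_iff)
    ultimately have "P - (q - 1) = J0 * J1 * q * F + 1" by (metis mult_left_cancel)
    then show "J0 * J1 * q * F = P - q" by (simp add: algebra_simps)
  next
    assume BB: "B * B = triv_char"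
    then have "Q = 1" by (simp add: Q_def)
    have "J0 = - 1" "J1 = - 1"
      unfolding J0_def J1_def BB using B quad_char_neq_triv[OF two]
      by (simp_all add: triv_char_mult mult_char_quad jacobi_sum_commute[of triv_char] jacobi_sum_triv_right
          mult_char_inverse inverse_char_eq_triv_iff)
    then have jc: "q * G ?\<phi> * j \<chi> = com \<chi>" if "mult_char \<chi>" for \<chi>
      using j[OF that] by (simp add: \<open>Q = 1\<close>)
    have R': "R \<chi> = \<chi> 8 * j \<chi> + (if \<chi> = ?T then q - 1 else 0)" if "\<chi> \<in> ?C" for \<chi>
    proof (cases "\<chi> = ?T")
      case False
      from that have \<chi>: "mult_char \<chi>" by simp
      have "R \<chi> * (q * (q * G ?\<phi>)) = (\<chi> 8 * j \<chi>) * (q * (q * G ?\<phi>))"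
        using R[OF \<chi>] False unfolding jc[OF \<chi>, symmetric] by (simp add: power2_eq_square mult_ac)
      then show ?thesis using q G\<phi> False by simp
    next
      case True
      have "?T 2 = 1" using two by (simp add: triv_char_def)
      then have "R ?T = q - 2"
        unfolding R_def BB using B jacobi_sum_triv_triv[where 'a = 'a]
        by (simp add: jacobi_sum_commute[of triv_char B] jacobi_sum_commute[of triv_char "inverse B"]
            jacobi_sum_triv_right mult_triv_char mc inverse_char_eq_triv_iff q_def)
      moreover have "(q * G ?\<phi>) * j ?T = (q * G ?\<phi>) * - 1"
        using jc[of ?T] com_triv by (simp add: mult_char_triv \<open>Q = 1\<close>)
      then have "j ?T = - 1" using q G\<phi> by (metis mult_cancel_left mult_eq_0_iff)
      ultimately show ?thesis by (simp add: True T8)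
    qed
    have "(q - 1) * (P - (q - 1)) = (\<Sum>\<chi>\<in>?C. \<chi> 8 * j \<chi> + (if \<chi> = ?T then q - 1 else 0))"
      unfolding P by (rule sum.cong[OF refl R'])
    also have "\<dots> = q ^ 2 * (q - 1) * F + (q - 1)"
      unfolding F sum.distrib using T fin by simp
    finally have "(q - 1) * (P - (q - 1)) = (q - 1) * (q ^ 2 * F + 1)"
      by (simp add: algebra_simps)
    then have "P - (q - 1) = q ^ 2 * F + 1" using q(2) by (metis mult_left_cancel)
    then show "q ^ 2 * F = P - q" by (simp add: algebra_simps)
  }
qed

text \<open>Negating \<open>a\<close> and \<open>b\<close> turns \<open>a * (a - a * b + 2)\<close>
  into \<open>a ^ 2 * (1 + b + - 2 / a)\<close>, the shape required by
  \<open>double_sum_transform\<close>; this is the origin of the shifts \<open>- 2\<close>.\<close>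

lemma double_sum_eq_cubic_product:
  fixes B :: "'a \<Rightarrow> complex"
  assumes B: "mult_char B" "B (- 1) = 1" "B \<noteq> triv_char" "B ^ 3 \<noteq> triv_char"
    and two: "(2::'a) \<noteq> 0" and three: "(3::'a) \<noteq> 0"
  shows "(\<Sum>c\<in>UNIV. \<Sum>b\<in>UNIV. B ((c / b) ^ 2) * inverse B (1 + b + c) * B (1 + - 2 / c + - 2 / b)) =
    (\<Sum>y\<in>UNIV. B (y ^ 3 - y)) * (\<Sum>z\<in>UNIV. inverse B (z ^ 3 - z))"
proof -
  let ?h = "\<lambda>a b. B (a * (a - a * b + 2) / (b * (b - a * b + 2)))"
  have "(\<Sum>y\<in>UNIV. B (y ^ 3 - y)) * (\<Sum>z\<in>UNIV. inverse B (z ^ 3 - z)) = (\<Sum>a\<in>UNIV. \<Sum>b\<in>UNIV. ?h a b)"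
    using assms by (rule cubic_product_birational)
  also have "\<dots> = (\<Sum>a\<in>UNIV. \<Sum>b\<in>UNIV. ?h (- a) b)"
    by (rule sum_UNIV_minus[symmetric])
  also have "\<dots> = (\<Sum>a\<in>UNIV. \<Sum>b\<in>UNIV. ?h (- a) (- b))"
    by (rule sum.cong[OF refl], rule sum_UNIV_minus[symmetric])
  also have "\<dots> = (\<Sum>a\<in>UNIV. \<Sum>b\<in>UNIV. B ((a / b) ^ 2) * B (1 + b + - 2 / a) * inverse B (1 + a + - 2 / b))"
  proof (rule sum.cong[OF refl], rule sum.cong[OF refl])
    fix a b :: 'a
    show "?h (- a) (- b) = B ((a / b) ^ 2) * B (1 + b + - 2 / a) * inverse B (1 + a + - 2 / b)"
    proof (cases "a = 0 \<or> b = 0")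
      case False
      then have "- a * (- a - - a * - b + 2) = a ^ 2 * (1 + b + - 2 / a)"
        "- b * (- b - - a * - b + 2) = b ^ 2 * (1 + a + - 2 / b)"
        by (simp_all add: field_simps power2_eq_square)
      then have "- a * (- a - - a * - b + 2) / (- b * (- b - - a * - b + 2)) =
          (a / b) ^ 2 * (1 + b + - 2 / a) / (1 + a + - 2 / b)"
        by (simp add: power_divide)
      then show ?thesis
        by (simp only: mult_char_divide[OF B(1)] mult_char_times[OF B(1)]) (simp add: divide_inverse)
    qed (use mult_char_0[OF B(1)] in auto)
  qed
  also have "\<dots> = (\<Sum>c\<in>UNIV. \<Sum>b\<in>UNIV. B ((c / b) ^ 2) * inverse B (1 + b + c) * B (1 + - 2 / c + - 2 / b))"
    by (rule double_sum_transform[OF B(1,3)])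
  finally show ?thesis ..
qed

end

section \<open>Translation of the prefactors and corrections into Jacobi sums\<close>

theorem theorem1p13:
  fixes A :: "'a::finite_field \<Rightarrow> complex" and \<zeta> :: complex and p r :: nat
  defines "q \<equiv> (of_nat CARD('a) :: complex)"
    and "g \<equiv> (gauss_sum p r \<zeta> :: ('a \<Rightarrow> complex) \<Rightarrow> complex)"
    and "\<phi> \<equiv> (quad_char :: 'a \<Rightarrow> complex)"
    and "\<epsilon> \<equiv> (triv_char :: 'a \<Rightarrow> complex)"
  assumes "prime p" and "odd p" and "p \<noteq> 3"
    and "CARD('a) = p ^ r"
    and "primitive_root_of_unity p \<zeta>"
    and "mult_char A"
    and "A ^ 2 \<noteq> \<epsilon>" and "A ^ 6 \<noteq> \<epsilon>" and "A ^ 4 \<noteq> \<phi>"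
  shows
    "greene_F (inverse (A ^ 2)) [A ^ 2, \<phi>] [A ^ 4, inverse (A ^ 4)] (- 8) =
       g \<phi> / (g (inverse (A ^ 4)) * g (A ^ 4 * \<phi>))
         * inverse (char_binom (inverse (A ^ 2)) (inverse (A ^ 4)))
         * (char_binom (inverse A) (A ^ 2) + char_binom (\<phi> * inverse A) (A ^ 2))
         * (char_binom A (inverse (A ^ 2)) + char_binom (\<phi> * A) (inverse (A ^ 2)))
     + (q - 1) / q * inverse (char_binom (inverse (A ^ 2)) (inverse (A ^ 4)))
         * greene_F (A ^ 2) [inverse (A ^ 2), \<phi>] [\<epsilon>, inverse (A ^ 4)] (- 8)
         * delta_char (inverse (A ^ 4))
     - 1 / q ^ 2 * char_binom \<phi> (inverse (A ^ 4))
         * inverse (char_binom (inverse (A ^ 2)) (inverse (A ^ 4)))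
     - (q - 1) * g \<phi> / (q ^ 3 * g (inverse (A ^ 4)) * g (A ^ 4 * \<phi>))
         * inverse (char_binom (inverse (A ^ 2)) (inverse (A ^ 4)))
         * (delta_char (inverse (A ^ 4)) + q)"
proof -
  interpret additive_character "add_char p r \<zeta> :: 'a \<Rightarrow> complex"
    using \<open>prime p\<close> \<open>CARD('a) = p ^ r\<close> \<open>primitive_root_of_unity p \<zeta>\<close> by (rule additive_character_add_char)
  have g: "g = G" by (simp add: fun_eq_iff g_def gauss_sum_def G_def)
  have char: "CHAR('a) = p" using \<open>prime p\<close> \<open>CARD('a) = p ^ r\<close> by (rule prime_char_field)
  have two: "(2::'a) \<noteq> 0"
  proof
    assume "(2::'a) = 0"
    then have "p dvd 2" using of_nat_eq_0_iff_char_dvd[of 2, where 'a = 'a] char by simp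
    then have "p \<le> 2" by (auto dest: dvd_imp_le)
    then show False using \<open>prime p\<close> \<open>odd p\<close> prime_ge_2_nat[of p] by (cases "p = 2") auto
  qed
  have three: "(3::'a) \<noteq> 0"
  proof
    assume "(3::'a) = 0"
    then have "p dvd 3" using of_nat_eq_0_iff_char_dvd[of 3, where 'a = 'a] char by simp
    then have "p = 3" using \<open>prime p\<close> primes_dvd_imp_eq[of p 3] by simp
    then show False using \<open>p \<noteq> 3\<close> by simp
  qed
  define B where "B = A ^ 2"
  have A: "mult_char A" by fact
  have AA: "A * A = B" by (simp add: B_def power2_eq_square)
  have A4: "A ^ 4 = B * B" by (simp add: B_def flip: power_add)
  have A6: "A ^ 6 = B ^ 3" by (simp add: B_def flip: power_mult)
  have B: "mult_char B" "B (- 1) = 1" "B \<noteq> triv_char" "B ^ 3 \<noteq> triv_char" "B * B \<noteq> quad_char"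
    using A mult_char_minus_1_square[OF A] \<open>A ^ 2 \<noteq> \<epsilon>\<close> \<open>A ^ 6 \<noteq> \<epsilon>\<close> \<open>A ^ 4 \<noteq> \<phi>\<close>
    by (simp_all add: mult_char_mult \<epsilon>_def \<phi>_def A6 A4 flip: B_def, simp_all flip: AA add: mult_char_mult)
  note mc = mult_char_mult mult_char_inverse mult_char_quad B(1)
  define J0 where "J0 = jacobi_sum (inverse (B * B)) (B * B * \<phi>)"
  define J1 where "J1 = jacobi_sum (inverse B) (B * B)"
  define J where "J = jacobi_sum \<phi> (B * B)"
  define F where "F = greene_F (inverse B) [B, \<phi>] [B * B, inverse (B * B)] (- 8)"
  define P1 where "P1 = (\<Sum>y\<in>UNIV. B (y ^ 3 - y))"
  define P2 where "P2 = (\<Sum>y\<in>UNIV. inverse B (y ^ 3 - y))"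
  have q: "q \<noteq> 0" by (simp add: q_def)
  have prods: "inverse (B * B) * (B * B * \<phi>) = \<phi>" "inverse B * (B * B) = B"
    using mult_inverse_char_cancel'(2)[of "B * B" \<phi>] mult_inverse_char_cancel'(2)[of B B] by (simp_all add: mc \<phi>_def)
  have \<phi>: "mult_char \<phi>" "\<phi> \<noteq> triv_char" "G \<phi> \<noteq> 0"
    by (simp_all add: \<phi>_def mult_char_quad quad_char_neq_triv[OF two] G_nonzero)
  have nz: "J0 \<noteq> 0" "J1 \<noteq> 0"
    unfolding J0_def J1_def by (intro jacobi_sum_nonzero; simp add: mc \<phi> prods B)+
  have "G (inverse (B * B)) * G (B * B * \<phi>) = J0 * G \<phi>"
    unfolding J0_def using G_mult[of "inverse (B * B)" "B * B * \<phi>"] by (simp add: mc \<phi> prods)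
  then have quot: "G \<phi> / (G (inverse (B * B)) * G (B * B * \<phi>)) = 1 / J0"
    using \<phi>(3) by simp
  have quot': "(q - 1) * G \<phi> / (q ^ 3 * G (inverse (B * B)) * G (B * B * \<phi>)) = (q - 1) / (q ^ 3 * J0)"
  proof -
    have "(q - 1) * G \<phi> / (q ^ 3 * G (inverse (B * B)) * G (B * B * \<phi>)) =
        (q - 1) / q ^ 3 * (G \<phi> / (G (inverse (B * B)) * G (B * B * \<phi>)))" by simp
    then show ?thesis unfolding quot by simp
  qed
  have binom: "char_binom \<chi> (inverse (B * B)) = jacobi_sum \<chi> (B * B) / q" for \<chi>
    unfolding char_binom_jacobi by (simp add: B(2) q_def)
  have pair1: "char_binom A (inverse B) + char_binom (\<phi> * A) (inverse B) = P1 / q"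
    using char_binom_pair[OF A two] unfolding AA by (simp add: P1_def q_def \<phi>_def)
  have pair2: "char_binom (inverse A) B + char_binom (\<phi> * inverse A) B = P2 / q"
    using char_binom_pair[OF mult_char_inverse[OF A] two]
    unfolding inverse_char_mult[symmetric] AA by (simp add: P2_def q_def \<phi>_def)
  have P: "(\<Sum>c\<in>UNIV. \<Sum>b\<in>UNIV. B ((c / b) ^ 2) * inverse B (1 + b + c) * B (1 + - 2 / c + - 2 / b)) = P1 * P2"
    unfolding P1_def P2_def by (rule double_sum_eq_cubic_product[OF B(1-4) two three])
  note main = greene_F_eq_double_sum[OF two B(1,2,3,5), folded \<phi>_def, folded q_def F_def J0_def J1_def, unfolded P]
  have delta: "delta_char (inverse (B * B)) = (if B * B = triv_char then 1 else 0)"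
    by (simp add: delta_char_def inverse_char_eq_triv_iff)
  show ?thesis
  proof (cases "B * B = triv_char")
    case False
    \<comment> \<open>The aim is \<open>J0 * J = q\<close>. It makes the last two terms of the
      formula \<open>1\<close> and \<open>q - 1\<close> over \<open>q * J0 * J1\<close>, up to sign,
      so that they combine to the \<open>q\<close> of \<open>main\<close>.\<close>
    have "jacobi_sum \<phi> (B * B) * G (\<phi> * (B * B)) = G \<phi> * G (B * B)"
    proof -
      have "\<phi> * (B * B) \<noteq> triv_char"
        using B(5) by (simp add: char_eq_inverse_iff mc \<phi> \<phi>_def inverse_quad_char)
      then show ?thesis using G_mult[of \<phi> "B * B"] by (simp add: mc \<phi>)
    qed
    moreover have "G (B * B) * G (inverse (B * B)) = q"
      using G_inverse[of "B * B"] False B(2) by (simp add: mc q_def)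
    moreover have "(G (inverse (B * B)) * G (B * B * \<phi>)) * (G \<phi> * G (B * B)) =
        (G (B * B) * G (inverse (B * B))) * (G \<phi> * G (B * B * \<phi>))"
      by (simp only: mult_ac)
    ultimately have "(G (inverse (B * B)) * G (B * B * \<phi>)) * (J * G (\<phi> * (B * B))) =
        q * (G \<phi> * G (B * B * \<phi>))"
      unfolding J_def by (simp only:)
    then have "J0 * J * (G \<phi> * G (B * B * \<phi>)) = q * (G \<phi> * G (B * B * \<phi>))"
      unfolding \<open>G (inverse (B * B)) * G (B * B * \<phi>) = J0 * G \<phi>\<close> by (simp only: mult_ac)
    moreover have "G \<phi> * G (B * B * \<phi>) \<noteq> 0"
      using \<phi>(3) by (simp add: G_nonzero mc \<phi>)
    ultimately have "J0 * J = q" by (metis mult_right_cancel)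
    then have J: "J = q / J0"
      using nz by (simp add: field_simps)
    have F: "F = (P1 * P2 - q) / (J0 * J1 * q)"
      using main(1)[OF False] nz q by (simp add: field_simps)
    show ?thesis
      unfolding g A4 B_def[symmetric] quot quot' binom pair1 pair2 delta F_def[symmetric] J1_def[symmetric] J_def[symmetric]
      unfolding F J using False nz q by (simp add: field_simps power2_eq_square power3_eq_cube)
  next
    case True
    have J: "J0 = - 1" "J1 = - 1" "J = - 1"
      unfolding J0_def J1_def J_def True using \<phi> B
      by (simp_all add: triv_char_mult jacobi_sum_commute[of triv_char] jacobi_sum_triv_right
          mult_char_inverse inverse_char_eq_triv_iff)
    have "inverse B = B" using True by (simp add: char_eq_inverse_iff B)
    \<comment> \<open>The delta term carries the series to be evaluated, with coefficient
      \<open>- (q - 1)\<close> because \<open>J1 = - 1\<close>. Moving it to the left gives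
      \<open>q * F\<close>, which \<open>main(2)\<close> determines.\<close>
    then have F': "greene_F B [inverse B, \<phi>] [\<epsilon>, inverse (B * B)] (- 8) = F"
      unfolding F_def \<epsilon>_def True by simp
    have F: "F = (P1 * P2 - q) / q ^ 2"
      using main(2)[OF True] q by (simp add: field_simps)
    show ?thesis
      unfolding g A4 B_def[symmetric] quot quot' binom pair1 pair2 delta F' F_def[symmetric] J1_def[symmetric] J_def[symmetric] J
      unfolding F using True q by (simp add: field_simps power2_eq_square power3_eq_cube)
  qed
qed

end
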